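(* Let $(\mathbb{S},\mathbb{P})$ be an $S$-structure and fix a linear ordering $\preceq$ on the set of domain types. Assume that each vertex $v\in\mathcal{V}$ admits at least one expansion. Then the $\Gamma_S$-complex $\Delta(\mathcal{V}^{ord})$ is contractible.
   Context: Setting. $X$ is a non-empty set. A partial bijection of $X$ is a bijection $f:A\to B$ between (possibly empty) subsets of $X$; for partial bijections $f:A\to B$, $g:C\to D$ the composition $gf$ is the partial bijection $f^{-1}(C)\to g(B\cap C)$, $x\mapsto g(f(x))$. $S$ is a set of partial bijections of $X$ closed under composition and inverses and containing the empty function. A domain is a set that is the domain of some $s\in S$; $\mathcal{D}^{+}$ is the set of non-empty domains. It is assumed that $X$ is a finite disjoint union of domains. $\widehat{S}$ is the set of all partial bijections $\hat s:A\to B$ of $X$ for which there are $m\ge 0$ and finite disjoint unions $A=\coprod_{i=1}^m D_i$, $B=\coprod_{i=1}^m E_i$ with each $\hat s_{|D_i}$ a bijection $D_i\to E_i$ belonging to $S$. An injective map $f:D\to X$ is locally determined by $S$ if $f:D\to f(D)$ belongs to $\widehat{S}$. $\Gamma_S$ is the group (under composition) of bijections $X\to X$ belonging to $\widehat{S}$. $S$-structures. For a partition $\mathcal{P}$ of $D$ and $E\subseteq D$, $\mathcal{P}_{|E}=\{P\cap E: P\in\mathcal{P},\,P\cap E\ne\emptyset\}$. An $S$-structure is a pair $(\mathbb{S},\mathbb{P})$, where $\mathbb{S}$ assigns to each $(D_1,D_2)\in\mathcal{D}^{+}\times\mathcal{D}^{+}$ a subset $\mathbb{S}(D_1,D_2)\subseteq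 S$ and $\mathbb{P}$ assigns to each $D\in\mathcal{D}^{+}$ a collection $\mathbb{P}(D)$ of partitions of $D$, such that: (P1) $\{D\}\in\mathbb{P}(D)$; (P2) each $\mathcal{P}\in\mathbb{P}(D)$ is a finite partition of $D$ into domains; (P3) if $\mathcal{P}\in\mathbb{P}(D)$ and $E\subseteq D$ is a non-empty domain, then $\mathcal{P}_{|E}\in\mathbb{P}(E)$; (P4) if $\{D_1,\dots,D_m\}\in\mathbb{P}(D)$ and $\mathcal{P}_i\in\mathbb{P}(D_i)$ for each $i$, then $\mathcal{P}_1\cup\dots\cup\mathcal{P}_m\in\mathbb{P}(D)$; (P5) every finite partition of $D\in\mathcal{D}^{+}$ into domains is refined by some $\mathcal{P}\in\mathbb{P}(D)$; (S1) each $s\in\mathbb{S}(D_1,D_2)$ has domain $D_1$ and image $D_2$; (S2) $\mathrm{id}_D\in\mathbb{S}(D,D)$; (S3) $s\in\mathbb{S}(D_1,D_2)$ implies $s^{-1}\in\mathbb{S}(D_2,D_1)$; (S4) $s_1\in\mathbb{S}(D_1,D_2)$ and $s_2\in\mathbb{S}(D_2,D_3)$ imply $s_2s_1\in\mathbb{S}(D_1,D_3)$; (S5) if $D\in\mathcal{D}^{+}$ and $f:D\to X$ is locally determined by $S$, there is $\mathcal{P}\in\mathbb{P}(D)$ such that for each $E\in\mathcal{P}$, $f_{|E}:E\to f(E)$ is an element of $S$ lying in $\mathbb{S}(E,f(E))$; (S6) if $\mathcal{P}\in\mathbb{P}(D_1)$ and $s\in\mathbb{S}(D_1,D_2)$,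 then $s(\mathcal{P})\in\mathbb{P}(D_2)$. Domains $D_1,D_2\in\mathcal{D}^{+}$ have the same domain type if $\mathbb{S}(D_1,D_2)\neq\emptyset$; this is an equivalence relation, and the class $[D]$ is the domain type of $D$. Vertices. On the set of pairs $(f,D)$ with $D\in\mathcal{D}^{+}$ and $f:D\to X$ locally determined by $S$, put $(f_1,D_1)\sim(f_2,D_2)$ if $f_1=f_2h$ for some $h\in\mathbb{S}(D_1,D_2)$. $[f,D]$ is the class of $(f,D)$, and $\mathcal{B}$ the set of classes; if $g$ is defined on a set containing $D$, $[g,D]$ means $[g_{|D},D]$. $\mathcal{V}$ is the set of all finite subsets $v=\{[f_1,D_1],\dots,[f_m,D_m]\}$ of $\mathcal{B}$ whose images $f_i(D_i)$ are pairwise disjoint with union $X$; its elements are called vertices. Expansion: $v\nearrow v'$ if $v'=(v-\{[f,D]\})\cup\{[fh,E]: E\in\mathcal{P}\}$ for some $[f,D]\in v$, some $\widehat{D}\in\mathcal{D}^{+}$, some $h\in\mathbb{S}(\widehat{D},D)$, and some $\mathcal{P}\in\mathbb{P}(\widehat{D})$ with $|\mathcal{P}|\ge 2$; "$v$ admits at least one expansion" means $v\nearrow v'$ for some $v'$. Write $v\le v'$ if $v'$ is obtained from $v$ by a finite (possibly empty) sequence of expansions; this is a partial order. Ordered vertices. $\mathcal{V}^{ord}$ is the set of all $m$-tuples $([f_1,D_1],\dots,[f_m,D_m])$ ($m\in\mathbb{N}$) of distinct elements such that $\{[f_1,D_1],\dots,[f_m,D_m]\}\in\mathcal{V}$ and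 $[D_i]\preceq[D_j]$ whenever $i<j$. Let $F:\mathcal{V}^{ord}\to\mathcal{V}$ send a tuple to its underlying set. $\mathcal{V}^{ord}$ is partially ordered by: $v_1<v_2$ if and only if $F(v_1)<F(v_2)$. $\Gamma_S$ acts on $\mathcal{V}^{ord}$ by $\gamma\cdot([f_1,D_1],\dots,[f_m,D_m])=([\gamma f_1,D_1],\dots,[\gamma f_m,D_m])$. The order complex $\Delta(P)$ of a partially ordered set $P$ is the simplicial complex with vertex set $P$ whose simplices are the non-empty finite chains of $P$; a $\Gamma_S$-complex is a simplicial complex with a simplicial $\Gamma_S$-action. *)

theory Defs
  imports "HOL-Analysis.Analysis" "HOL-Algebra.Group_Action" "HOL-Library.Disjoint_Sets"
begin

section \<open>Partial bijections\<close>

text \<open>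
  A partial bijection is represented by its graph. Relation composition is written in
  diagrammatic order, so the composition ``g after f'' is \<open>f O g\<close>; its domain
  and range are automatically the maximal ones. The inverse is the converse, and the image of
  a set \<open>A\<close> under \<open>f\<close> is \<open>f `` A\<close>.
\<close>

definition partial_bijection :: "'a set \<Rightarrow> 'a rel \<Rightarrow> bool" where
  "partial_bijection X f \<longleftrightarrow> f \<subseteq> X \<times> X \<and> single_valued f \<and> single_valued (f\<inverse>)"

definition prestrict :: "'a rel \<Rightarrow> 'a set \<Rightarrow> 'a rel" where
  "prestrict f E = {(x, y) \<in> f. x \<in> E}"

definition doms :: "'a rel set \<Rightarrow> 'a set set" where
  "doms S = Domain ` S"

definition nonempty_doms :: "'a rel set \<Rightarrow> 'a set set" where
  "nonempty_doms S = doms S - {{}}"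

locale partial_bijections =
  fixes X :: "'a set" and S :: "'a rel set"
  assumes X_nonempty: "X \<noteq> {}"
    and S_partial_bijection: "s \<in> S \<Longrightarrow> partial_bijection X s"
    and S_comp: "s \<in> S \<Longrightarrow> t \<in> S \<Longrightarrow> s O t \<in> S"
    and S_inverse: "s \<in> S \<Longrightarrow> s\<inverse> \<in> S"
    and S_empty: "{} \<in> S"
    and X_finite_union: "\<exists>\<D>. finite \<D> \<and> \<D> \<subseteq> doms S \<and> disjoint \<D> \<and> \<Union>\<D> = X"

definition hat :: "'a set \<Rightarrow> 'a rel set \<Rightarrow> 'a rel set" where
  "hat X S = {s. partial_bijection X s \<and>
     (\<exists>(m::nat) D E.
        disjoint_family_on D {..<m} \<and> Domain s = (\<Union>i<m. D i) \<and>
        disjoint_family_on E {..<m} \<and> Range s = (\<Union>i<m. E i) \<and>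
        (\<forall>i<m. s `` D i = E i \<and> prestrict s (D i) \<in> S))}"

text \<open>An injective map \<open>D \<rightarrow> X\<close> is identified with the bijection from
  \<open>D\<close> onto its image.\<close>

definition locally_determined :: "'a set \<Rightarrow> 'a rel set \<Rightarrow> 'a rel \<Rightarrow> 'a set \<Rightarrow> bool" where
  "locally_determined X S f D \<longleftrightarrow> Domain f = D \<and> f \<in> hat X S"

definition Gamma :: "'a set \<Rightarrow> 'a rel set \<Rightarrow> 'a rel monoid" where
  "Gamma X S = \<lparr>carrier = {\<gamma> \<in> hat X S. Domain \<gamma> = X \<and> Range \<gamma> = X},
                mult = (\<lambda>\<gamma> \<delta>. \<delta> O \<gamma>), one = Id_on X\<rparr>"


section \<open>Structures on a set of partial bijections\<close>

definition restrict_partition :: "'a set set \<Rightarrow> 'a set \<Rightarrow> 'a set set" where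
  "restrict_partition \<P> E = {P \<inter> E | P. P \<in> \<P> \<and> P \<inter> E \<noteq> {}}"

text \<open>Only the values of \<open>SS\<close> and \<open>PP\<close> at non-empty domains are
  constrained, and only these values are used below.\<close>

locale S_structure = partial_bijections X S
  for X :: "'a set" and S :: "'a rel set" +
  fixes SS :: "'a set \<Rightarrow> 'a set \<Rightarrow> 'a rel set"
    and PP :: "'a set \<Rightarrow> 'a set set set"
  assumes SS_subset: "D1 \<in> nonempty_doms S \<Longrightarrow> D2 \<in> nonempty_doms S \<Longrightarrow> SS D1 D2 \<subseteq> S"
    and PP_partition: "D \<in> nonempty_doms S \<Longrightarrow> \<P> \<in> PP D \<Longrightarrow> partition_on D \<P>"
    and P1: "D \<in> nonempty_doms S \<Longrightarrow> {D} \<in> PP D"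
    and P2: "D \<in> nonempty_doms S \<Longrightarrow> \<P> \<in> PP D \<Longrightarrow> finite \<P> \<and> \<P> \<subseteq> doms S"
    and P3: "D \<in> nonempty_doms S \<Longrightarrow> \<P> \<in> PP D \<Longrightarrow> E \<in> nonempty_doms S \<Longrightarrow> E \<subseteq> D \<Longrightarrow>
               restrict_partition \<P> E \<in> PP E"
    and P4: "D \<in> nonempty_doms S \<Longrightarrow> \<P> \<in> PP D \<Longrightarrow> (\<And>E. E \<in> \<P> \<Longrightarrow> \<R> E \<in> PP E) \<Longrightarrow>
               (\<Union>E\<in>\<P>. \<R> E) \<in> PP D"
    and P5: "D \<in> nonempty_doms S \<Longrightarrow> partition_on D \<Q> \<Longrightarrow> finite \<Q> \<Longrightarrow> \<Q> \<subseteq> doms S \<Longrightarrow>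
               \<exists>\<P> \<in> PP D. refines D \<P> \<Q>"
    and S1: "D1 \<in> nonempty_doms S \<Longrightarrow> D2 \<in> nonempty_doms S \<Longrightarrow> s \<in> SS D1 D2 \<Longrightarrow>
               Domain s = D1 \<and> Range s = D2"
    and S2: "D \<in> nonempty_doms S \<Longrightarrow> Id_on D \<in> SS D D"
    and S3: "D1 \<in> nonempty_doms S \<Longrightarrow> D2 \<in> nonempty_doms S \<Longrightarrow> s \<in> SS D1 D2 \<Longrightarrow>
               s\<inverse> \<in> SS D2 D1"
    and S4: "D1 \<in> nonempty_doms S \<Longrightarrow> D2 \<in> nonempty_doms S \<Longrightarrow> D3 \<in> nonempty_doms S \<Longrightarrow>
               s1 \<in> SS D1 D2 \<Longrightarrow> s2 \<in> SS D2 D3 \<Longrightarrow> s1 O s2 \<in> SS D1 D3"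
    and S5: "D \<in> nonempty_doms S \<Longrightarrow> locally_determined X S f D \<Longrightarrow>
               \<exists>\<P> \<in> PP D. \<forall>E\<in>\<P>. prestrict f E \<in> S \<and> prestrict f E \<in> SS E (f `` E)"
    and S6: "D1 \<in> nonempty_doms S \<Longrightarrow> D2 \<in> nonempty_doms S \<Longrightarrow> \<P> \<in> PP D1 \<Longrightarrow> s \<in> SS D1 D2 \<Longrightarrow>
               (\<lambda>P. s `` P) ` \<P> \<in> PP D2"

definition same_domain_type ::
    "'a rel set \<Rightarrow> ('a set \<Rightarrow> 'a set \<Rightarrow> 'a rel set) \<Rightarrow> 'a set rel" where
  "same_domain_type S SS =
     {(D1, D2). D1 \<in> nonempty_doms S \<and> D2 \<in> nonempty_doms S \<and> SS D1 D2 \<noteq> {}}"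

definition domain_type ::
    "'a rel set \<Rightarrow> ('a set \<Rightarrow> 'a set \<Rightarrow> 'a rel set) \<Rightarrow> 'a set \<Rightarrow> 'a set set" where
  "domain_type S SS D = same_domain_type S SS `` {D}"

definition domain_types ::
    "'a rel set \<Rightarrow> ('a set \<Rightarrow> 'a set \<Rightarrow> 'a rel set) \<Rightarrow> 'a set set set" where
  "domain_types S SS = nonempty_doms S // same_domain_type S SS"


section \<open>Vertices and expansions\<close>

definition local_pairs :: "'a set \<Rightarrow> 'a rel set \<Rightarrow> ('a rel \<times> 'a set) set" where
  "local_pairs X S = {(f, D). D \<in> nonempty_doms S \<and> locally_determined X S f D}"

definition pair_rel ::
    "'a set \<Rightarrow> 'a rel set \<Rightarrow> ('a set \<Rightarrow> 'a set \<Rightarrow> 'a rel set) \<Rightarrow> ('a rel \<times> 'a set) rel" where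
  "pair_rel X S SS =
     {((f1, D1), (f2, D2)). (f1, D1) \<in> local_pairs X S \<and> (f2, D2) \<in> local_pairs X S \<and>
        (\<exists>h \<in> SS D1 D2. f1 = h O f2)}"

definition pair_class ::
    "'a set \<Rightarrow> 'a rel set \<Rightarrow> ('a set \<Rightarrow> 'a set \<Rightarrow> 'a rel set) \<Rightarrow> 'a rel \<Rightarrow> 'a set \<Rightarrow>
     ('a rel \<times> 'a set) set" where
  "pair_class X S SS f D = pair_rel X S SS `` {(prestrict f D, D)}"

definition pair_classes ::
    "'a set \<Rightarrow> 'a rel set \<Rightarrow> ('a set \<Rightarrow> 'a set \<Rightarrow> 'a rel set) \<Rightarrow> ('a rel \<times> 'a set) set set" where
  "pair_classes X S SS = local_pairs X S // pair_rel X S SS"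

text \<open>The image of a class, the domain type of a class and the translate of a class by an
  element of the group are defined as unions over the representatives, all of which contribute
  the same set; see the lemmas below.\<close>

definition class_image :: "('a rel \<times> 'a set) set \<Rightarrow> 'a set" where
  "class_image b = (\<Union>(f, D)\<in>b. f `` D)"

definition class_type ::
    "'a rel set \<Rightarrow> ('a set \<Rightarrow> 'a set \<Rightarrow> 'a rel set) \<Rightarrow> ('a rel \<times> 'a set) set \<Rightarrow> 'a set set" where
  "class_type S SS b = (\<Union>(f, D)\<in>b. domain_type S SS D)"

definition class_translate ::
    "'a set \<Rightarrow> 'a rel set \<Rightarrow> ('a set \<Rightarrow> 'a set \<Rightarrow> 'a rel set) \<Rightarrow> 'a rel \<Rightarrow>
     ('a rel \<times> 'a set) set \<Rightarrow> ('a rel \<times> 'a set) set" where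
  "class_translate X S SS \<gamma> b = (\<Union>(f, D)\<in>b. pair_class X S SS (f O \<gamma>) D)"

definition vertices ::
    "'a set \<Rightarrow> 'a rel set \<Rightarrow> ('a set \<Rightarrow> 'a set \<Rightarrow> 'a rel set) \<Rightarrow>
     ('a rel \<times> 'a set) set set set" where
  "vertices X S SS =
     {v. finite v \<and> v \<subseteq> pair_classes X S SS \<and>
         disjoint_family_on class_image v \<and> (\<Union>b\<in>v. class_image b) = X}"

definition expansion ::
    "'a set \<Rightarrow> 'a rel set \<Rightarrow> ('a set \<Rightarrow> 'a set \<Rightarrow> 'a rel set) \<Rightarrow> ('a set \<Rightarrow> 'a set set set) \<Rightarrow>
     ('a rel \<times> 'a set) set set \<Rightarrow> ('a rel \<times> 'a set) set set \<Rightarrow> bool" where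
  "expansion X S SS PP v v' \<longleftrightarrow>
     v \<in> vertices X S SS \<and>
     (\<exists>f D D' h \<P>. (f, D) \<in> local_pairs X S \<and> pair_class X S SS f D \<in> v \<and>
        D' \<in> nonempty_doms S \<and> h \<in> SS D' D \<and> \<P> \<in> PP D' \<and> card \<P> \<ge> 2 \<and>
        v' = (v - {pair_class X S SS f D}) \<union> {pair_class X S SS (h O f) E | E. E \<in> \<P>})"

definition vertex_le ::
    "'a set \<Rightarrow> 'a rel set \<Rightarrow> ('a set \<Rightarrow> 'a set \<Rightarrow> 'a rel set) \<Rightarrow> ('a set \<Rightarrow> 'a set set set) \<Rightarrow>
     ('a rel \<times> 'a set) set set \<Rightarrow> ('a rel \<times> 'a set) set set \<Rightarrow> bool" where
  "vertex_le X S SS PP = (expansion X S SS PP)\<^sup>*\<^sup>*"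


section \<open>Ordered vertices\<close>

text \<open>\<open>R\<close> is the linear order on domain types.\<close>

definition ord_vertices ::
    "'a set \<Rightarrow> 'a rel set \<Rightarrow> ('a set \<Rightarrow> 'a set \<Rightarrow> 'a rel set) \<Rightarrow> 'a set set rel \<Rightarrow>
     ('a rel \<times> 'a set) set list set" where
  "ord_vertices X S SS R =
     {bs. distinct bs \<and> set bs \<in> vertices X S SS \<and>
          sorted_wrt (\<lambda>b c. (class_type S SS b, class_type S SS c) \<in> R) bs}"

definition ord_vertices_order ::
    "'a set \<Rightarrow> 'a rel set \<Rightarrow> ('a set \<Rightarrow> 'a set \<Rightarrow> 'a rel set) \<Rightarrow> ('a set \<Rightarrow> 'a set set set) \<Rightarrow>
     'a set set rel \<Rightarrow> ('a rel \<times> 'a set) set list rel" where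
  "ord_vertices_order X S SS PP R =
     {(bs, cs). bs \<in> ord_vertices X S SS R \<and> cs \<in> ord_vertices X S SS R \<and>
        (bs = cs \<or> vertex_le X S SS PP (set bs) (set cs) \<and> set bs \<noteq> set cs)}"

definition ord_vertices_action ::
    "'a set \<Rightarrow> 'a rel set \<Rightarrow> ('a set \<Rightarrow> 'a set \<Rightarrow> 'a rel set) \<Rightarrow> 'a set set rel \<Rightarrow>
     'a rel \<Rightarrow> ('a rel \<times> 'a set) set list \<Rightarrow> ('a rel \<times> 'a set) set list" where
  "ord_vertices_action X S SS R \<gamma> =
     restrict (map (class_translate X S SS \<gamma>)) (ord_vertices X S SS R)"


section \<open>Simplicial complexes\<close>

definition order_complex :: "'v set \<Rightarrow> 'v rel \<Rightarrow> 'v set set" where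
  "order_complex P r = {\<sigma>. \<sigma> \<subseteq> P \<and> finite \<sigma> \<and> \<sigma> \<noteq> {} \<and> \<sigma> \<in> Chains r}"

definition simplicial_group_action ::
    "'g monoid \<Rightarrow> 'v set \<Rightarrow> 'v set set \<Rightarrow> ('g \<Rightarrow> 'v \<Rightarrow> 'v) \<Rightarrow> bool" where
  "simplicial_group_action G V K \<phi> \<longleftrightarrow>
     group_action G V \<phi> \<and> (\<forall>g\<in>carrier G. \<forall>\<sigma>\<in>K. \<phi> g ` \<sigma> \<in> K)"

text \<open>Geometric realization by barycentric coordinates. A closed simplex carries its Euclidean
  topology, i.e. the subspace topology of the product topology on functions, and a set is
  open iff it meets every closed simplex in an open subset of that simplex.\<close>

definition closed_simplex :: "'v set \<Rightarrow> ('v \<Rightarrow> real) set" where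
  "closed_simplex \<sigma> = {t. (\<forall>x. 0 \<le> t x) \<and> (\<forall>x. x \<notin> \<sigma> \<longrightarrow> t x = 0) \<and> sum t \<sigma> = 1}"

definition realization :: "'v set set \<Rightarrow> ('v \<Rightarrow> real) topology" where
  "realization K = topology (\<lambda>U. U \<subseteq> (\<Union>\<sigma>\<in>K. closed_simplex \<sigma>) \<and>
     (\<forall>\<sigma>\<in>K. openin (top_of_set (closed_simplex \<sigma>)) (U \<inter> closed_simplex \<sigma>)))"

lemma openin_realization:
  "openin (realization K) U \<longleftrightarrow> U \<subseteq> (\<Union>\<sigma>\<in>K. closed_simplex \<sigma>) \<and>
     (\<forall>\<sigma>\<in>K. openin (top_of_set (closed_simplex \<sigma>)) (U \<inter> closed_simplex \<sigma>))"
proof -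
  have "istopology (\<lambda>U. U \<subseteq> (\<Union>\<sigma>\<in>K. closed_simplex \<sigma>) \<and>
     (\<forall>\<sigma>\<in>K. openin (top_of_set (closed_simplex \<sigma>)) (U \<inter> closed_simplex \<sigma>)))"
    unfolding istopology_def
  proof (intro conjI allI impI ballI)
    fix U V \<sigma>
    assume "U \<subseteq> (\<Union>\<sigma>\<in>K. closed_simplex \<sigma>) \<and>
        (\<forall>\<sigma>\<in>K. openin (top_of_set (closed_simplex \<sigma>)) (U \<inter> closed_simplex \<sigma>))"
      and "V \<subseteq> (\<Union>\<sigma>\<in>K. closed_simplex \<sigma>) \<and>
        (\<forall>\<sigma>\<in>K. openin (top_of_set (closed_simplex \<sigma>)) (V \<inter> closed_simplex \<sigma>))"
      and "\<sigma> \<in> K"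
    then have "openin (top_of_set (closed_simplex \<sigma>))
        ((U \<inter> closed_simplex \<sigma>) \<inter> (V \<inter> closed_simplex \<sigma>))"
      by (blast intro: openin_Int)
    moreover have "(U \<inter> closed_simplex \<sigma>) \<inter> (V \<inter> closed_simplex \<sigma>) = U \<inter> V \<inter> closed_simplex \<sigma>"
      by blast
    ultimately show "openin (top_of_set (closed_simplex \<sigma>)) (U \<inter> V \<inter> closed_simplex \<sigma>)"
      by simp
  next
    fix \<U> \<sigma>
    assume A: "\<forall>U\<in>\<U>. U \<subseteq> (\<Union>\<sigma>\<in>K. closed_simplex \<sigma>) \<and>
        (\<forall>\<sigma>\<in>K. openin (top_of_set (closed_simplex \<sigma>)) (U \<inter> closed_simplex \<sigma>))"
      and "\<sigma> \<in> K"
    then have "openin (top_of_set (closed_simplex \<sigma>)) (\<Union>U\<in>\<U>. U \<inter> closed_simplex \<sigma>)"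
      by (intro openin_Union) auto
    moreover have "(\<Union>U\<in>\<U>. U \<inter> closed_simplex \<sigma>) = \<Union>\<U> \<inter> closed_simplex \<sigma>"
      by blast
    ultimately show "openin (top_of_set (closed_simplex \<sigma>)) (\<Union>\<U> \<inter> closed_simplex \<sigma>)"
      by simp
  qed blast+
  then show ?thesis
    by (simp add: realization_def topology_inverse')
qed

lemma topspace_realization: "topspace (realization K) = (\<Union>\<sigma>\<in>K. closed_simplex \<sigma>)"
proof
  show "topspace (realization K) \<subseteq> (\<Union>\<sigma>\<in>K. closed_simplex \<sigma>)"
    using openin_realization[of K "topspace (realization K)"] by simp
  have "openin (realization K) (\<Union>\<sigma>\<in>K. closed_simplex \<sigma>)"
    unfolding openin_realization
  proof (intro conjI ballI)
    fix \<sigma> assume "\<sigma> \<in> K"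
    then have "(\<Union>\<sigma>\<in>K. closed_simplex \<sigma>) \<inter> closed_simplex \<sigma> = closed_simplex \<sigma>"
      by blast
    then show "openin (top_of_set (closed_simplex \<sigma>))
        ((\<Union>\<sigma>\<in>K. closed_simplex \<sigma>) \<inter> closed_simplex \<sigma>)"
      by simp
  qed simp
  then show "(\<Union>\<sigma>\<in>K. closed_simplex \<sigma>) \<subseteq> topspace (realization K)"
    by (rule openin_subset)
qed

text \<open>The library's \<open>contractible_space\<close> holds of the empty space.\<close>

definition contractible_complex :: "'v set set \<Rightarrow> bool" where
  "contractible_complex K \<longleftrightarrow>
     topspace (realization K) \<noteq> {} \<and> contractible_space (realization K)"


section \<open>Independence of representatives\<close>

context S_structure
begin

lemma equiv_same_domain_type: "equiv (nonempty_doms S) (same_domain_type S SS)"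
proof (rule equivI)
  show "same_domain_type S SS \<subseteq> nonempty_doms S \<times> nonempty_doms S"
    by (auto simp: same_domain_type_def)
  show "refl_on (nonempty_doms S) (same_domain_type S SS)"
    using S2 by (auto simp: refl_on_def same_domain_type_def)
  show "sym (same_domain_type S SS)"
    using S3 by (fastforce simp: sym_def same_domain_type_def)
  show "trans (same_domain_type S SS)"
  proof (rule transI)
    fix A B C
    assume "(A, B) \<in> same_domain_type S SS" "(B, C) \<in> same_domain_type S SS"
    then obtain s t where *: "A \<in> nonempty_doms S" "B \<in> nonempty_doms S" "C \<in> nonempty_doms S"
        "s \<in> SS A B" "t \<in> SS B C"
      unfolding same_domain_type_def by blast
    with S4[OF *] show "(A, C) \<in> same_domain_type S SS"
      unfolding same_domain_type_def by blast
  qed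
qed

lemma SS_inverse_comp:
  assumes "D1 \<in> nonempty_doms S" "D2 \<in> nonempty_doms S" "h \<in> SS D1 D2"
  shows "h\<inverse> O h = Id_on D2"
proof -
  have "single_valued h"
    using assms SS_subset S_partial_bijection unfolding partial_bijection_def by blast
  moreover have "Range h = D2"
    using S1 assms by blast
  ultimately show ?thesis
    by (auto simp: single_valued_def)
qed

lemma local_pairs_Id_comp: "(f, D) \<in> local_pairs X S \<Longrightarrow> Id_on D O f = f"
  unfolding local_pairs_def locally_determined_def by auto

lemma equiv_pair_rel: "equiv (local_pairs X S) (pair_rel X S SS)"
proof (rule equivI)
  show "pair_rel X S SS \<subseteq> local_pairs X S \<times> local_pairs X S"
    by (auto simp: pair_rel_def)
  show "refl_on (local_pairs X S) (pair_rel X S SS)"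
  proof (rule refl_onI, clarify)
    fix f D assume "(f, D) \<in> local_pairs X S"
    moreover from this have "Id_on D \<in> SS D D"
      using S2 by (auto simp: local_pairs_def)
    moreover from calculation(1) have "f = Id_on D O f"
      by (rule local_pairs_Id_comp[symmetric])
    ultimately show "((f, D), (f, D)) \<in> pair_rel X S SS"
      unfolding pair_rel_def by blast
  qed
  show "sym (pair_rel X S SS)"
  proof (rule symI, clarify)
    fix f D g E assume "((f, D), (g, E)) \<in> pair_rel X S SS"
    then obtain h where h: "(f, D) \<in> local_pairs X S" "(g, E) \<in> local_pairs X S"
        "h \<in> SS D E" "f = h O g"
      unfolding pair_rel_def by blast
    then have dom: "D \<in> nonempty_doms S" "E \<in> nonempty_doms S"
      by (auto simp: local_pairs_def)
    have "h\<inverse> O f = Id_on E O g"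
      unfolding h(4) O_assoc[symmetric] SS_inverse_comp[OF dom h(3)] ..
    then have "g = h\<inverse> O f"
      using local_pairs_Id_comp[OF h(2)] by simp
    then show "((g, E), (f, D)) \<in> pair_rel X S SS"
      using h S3[OF dom h(3)] unfolding pair_rel_def by blast
  qed
  show "trans (pair_rel X S SS)"
  proof (rule transI, clarify)
    fix f D g E k F
    assume "((f, D), (g, E)) \<in> pair_rel X S SS" "((g, E), (k, F)) \<in> pair_rel X S SS"
    then obtain h h' where h: "(f, D) \<in> local_pairs X S" "(g, E) \<in> local_pairs X S"
        "(k, F) \<in> local_pairs X S" "h \<in> SS D E" "f = h O g" "h' \<in> SS E F" "g = h' O k"
      unfolding pair_rel_def by blast
    then have "h O h' \<in> SS D F"
      using S4[of D E F h h'] by (auto simp: local_pairs_def)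
    moreover have "f = (h O h') O k"
      using h by (simp add: O_assoc)
    ultimately show "((f, D), (k, F)) \<in> pair_rel X S SS"
      using h unfolding pair_rel_def by blast
  qed
qed

lemma prestrict_local_pair: "(f, D) \<in> local_pairs X S \<Longrightarrow> prestrict f D = f"
  unfolding local_pairs_def locally_determined_def prestrict_def by auto

lemma self_in_pair_class:
  assumes "(f, D) \<in> local_pairs X S"
  shows "(f, D) \<in> pair_class X S SS f D"
  using equiv_class_self[OF equiv_pair_rel assms]
  by (simp add: pair_class_def prestrict_local_pair[OF assms])

lemma pair_class_eq_iff:
  assumes "(f, D) \<in> local_pairs X S" "(g, E) \<in> local_pairs X S"
  shows "pair_class X S SS f D = pair_class X S SS g E \<longleftrightarrow> (\<exists>h \<in> SS D E. f = h O g)"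
proof -
  have "pair_class X S SS f D = pair_class X S SS g E \<longleftrightarrow>
      ((f, D), (g, E)) \<in> pair_rel X S SS"
    unfolding pair_class_def
    using eq_equiv_class_iff[OF equiv_pair_rel assms] by (simp add: prestrict_local_pair assms)
  then show ?thesis
    using assms by (auto simp: pair_rel_def)
qed

lemma in_pair_classD:
  assumes "(f, D) \<in> local_pairs X S" "(g, E) \<in> pair_class X S SS f D"
  shows "(g, E) \<in> local_pairs X S" "\<exists>h \<in> SS D E. f = h O g"
  using assms unfolding pair_class_def by (auto simp: prestrict_local_pair pair_rel_def)

lemma class_image_eq:
  assumes "(f, D) \<in> local_pairs X S"
  shows "class_image (pair_class X S SS f D) = f `` D"
proof -
  have "g `` E = f `` D" if gE: "(g, E) \<in> pair_class X S SS f D" for g E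
  proof -
    obtain h where h: "h \<in> SS D E" "f = h O g"
      using in_pair_classD[OF assms gE] by blast
    moreover have "D \<in> nonempty_doms S" "E \<in> nonempty_doms S"
      using assms in_pair_classD(1)[OF assms gE] by (auto simp: local_pairs_def)
    ultimately have "h `` D = E"
      using S1 by fastforce
    then show ?thesis
      using h by (simp add: relcomp_Image)
  qed
  then show ?thesis
    using self_in_pair_class[OF assms] unfolding class_image_def by blast
qed

lemma class_type_eq:
  assumes "(f, D) \<in> local_pairs X S"
  shows "class_type S SS (pair_class X S SS f D) = domain_type S SS D"
proof -
  have "domain_type S SS E = domain_type S SS D" if gE: "(g, E) \<in> pair_class X S SS f D" for g E
  proof -
    have "(D, E) \<in> same_domain_type S SS"
      using assms in_pair_classD[OF assms gE]
      by (auto simp: same_domain_type_def local_pairs_def)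
    then show ?thesis
      unfolding domain_type_def using equiv_class_eq[OF equiv_same_domain_type] by blast
  qed
  then show ?thesis
    using self_in_pair_class[OF assms] unfolding class_type_def by blast
qed

lemma hat_iff:
  "s \<in> hat X S \<longleftrightarrow> partial_bijection X s \<and>
     (\<exists>\<D>. finite \<D> \<and> disjoint \<D> \<and> Domain s = \<Union>\<D> \<and> (\<forall>D\<in>\<D>. prestrict s D \<in> S))"
  (is "?L \<longleftrightarrow> ?R")
proof
  assume L: ?L
  then have "partial_bijection X s"
    by (simp add: hat_def)
  moreover from L obtain m :: nat and D E where D: "disjoint_family_on D {..<m}"
      "Domain s = (\<Union>i<m. D i)" "\<forall>i<m. s `` D i = E i \<and> prestrict s (D i) \<in> S"
    unfolding hat_def mem_Collect_eq by (elim conjE exE)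
  moreover from D(1) have "disjoint (D ` {..<m})"
    by (rule disjoint_family_on_disjoint_image)
  moreover have "finite (D ` {..<m})"
    by simp
  moreover from D have "Domain s = \<Union>(D ` {..<m})" "\<forall>A \<in> D ` {..<m}. prestrict s A \<in> S"
    by auto
  ultimately show ?R
    by (intro conjI exI[of _ "D ` {..<m}"])
next
  assume R: ?R
  then obtain \<D> where \<D>: "finite \<D>" "disjoint \<D>" "Domain s = \<Union>\<D>"
      "\<forall>D\<in>\<D>. prestrict s D \<in> S"
    by blast
  obtain D where "bij_betw D {0..<card \<D>} \<D>"
    using ex_bij_betw_nat_finite[OF \<D>(1)] by blast
  then have inj: "inj_on D {..<card \<D>}" and im: "D ` {..<card \<D>} = \<D>"
    by (auto simp: bij_betw_def atLeast0LessThan)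
  have "D i \<inter> D j = {}" if "i < card \<D>" "j < card \<D>" "i \<noteq> j" for i j
  proof -
    have "D i \<in> \<D>" "D j \<in> \<D>"
      using im that by auto
    moreover have "D i \<noteq> D j"
      using that inj by (auto simp: inj_on_def)
    ultimately show ?thesis
      using disjointD[OF \<D>(2)] by blast
  qed
  then have disj: "disjoint_family_on D {..<card \<D>}"
    by (auto simp: disjoint_family_on_def)
  have "single_valued (s\<inverse>)"
    using R by (simp add: partial_bijection_def)
  then have "s `` A \<inter> s `` B = {}" if "A \<inter> B = {}" for A B
    using that by (auto simp: single_valued_def)
  then have disjE: "disjoint_family_on (\<lambda>i. s `` D i) {..<card \<D>}"
    using disj by (simp add: disjoint_family_on_def)
  have dom: "Domain s = (\<Union>i<card \<D>. D i)"
    using \<D>(3) im by simp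
  have "s `` Domain s = Range s"
    by auto
  then have "s `` (\<Union>i<card \<D>. D i) = Range s"
    by (simp only: dom)
  then have ran: "Range s = (\<Union>i<card \<D>. s `` D i)"
    by (simp add: Image_UN)
  have "\<forall>i<card \<D>. s `` D i = s `` D i \<and> prestrict s (D i) \<in> S"
    using \<D>(4) im by auto
  moreover have "partial_bijection X s"
    using R by blast
  ultimately show ?L
    unfolding hat_def mem_Collect_eq using disj dom disjE ran
    by (intro conjI exI[of _ "card \<D>"] exI[of _ D] exI[of _ "\<lambda>i. s `` D i"])
qed

lemma hat_comp:
  assumes "s \<in> hat X S" "t \<in> hat X S"
  shows "s O t \<in> hat X S"
proof -
  obtain \<D> where \<D>: "finite \<D>" "disjoint \<D>" "Domain s = \<Union>\<D>" "\<forall>D\<in>\<D>. prestrict s D \<in> S"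
    and s: "partial_bijection X s"
    using assms(1) unfolding hat_iff by blast
  obtain \<E> where \<E>: "finite \<E>" "disjoint \<E>" "Domain t = \<Union>\<E>" "\<forall>E\<in>\<E>. prestrict t E \<in> S"
    and t: "partial_bijection X t"
    using assms(2) unfolding hat_iff by blast
  have pb: "partial_bijection X (s O t)"
    using s t unfolding partial_bijection_def
    by (auto simp: converse_relcomp intro: single_valued_relcomp)
  define F where "F = (\<lambda>(D, E). Domain (prestrict s D O prestrict t E))"
  have sv: "y = z" if "(x, y) \<in> s" "(x, z) \<in> s" for x y z
    using s that by (auto simp: partial_bijection_def single_valued_def)
  have "prestrict (s O t) (F (D, E)) = prestrict s D O prestrict t E" for D E
    by (auto simp: F_def prestrict_def dest: sv)
  then have "\<forall>A \<in> F ` (\<D> \<times> \<E>). prestrict (s O t) A \<in> S"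
    using \<D>(4) \<E>(4) S_comp by auto
  moreover have "Domain (s O t) = \<Union>(F ` (\<D> \<times> \<E>))"
  proof
    show "Domain (s O t) \<subseteq> \<Union>(F ` (\<D> \<times> \<E>))"
    proof
      fix x assume "x \<in> Domain (s O t)"
      then obtain y z where yz: "(x, y) \<in> s" "(y, z) \<in> t"
        by blast
      then obtain D E where "D \<in> \<D>" "x \<in> D" "E \<in> \<E>" "y \<in> E"
        using \<D>(3) \<E>(3) by blast
      moreover from this yz have "x \<in> F (D, E)"
        by (auto simp: F_def prestrict_def)
      ultimately show "x \<in> \<Union>(F ` (\<D> \<times> \<E>))"
        by blast
    qed
  qed (auto simp: F_def prestrict_def)
  moreover have "disjoint (F ` (\<D> \<times> \<E>))"
  proof (rule disjointI, rule ccontr)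
    fix A B assume AB: "A \<in> F ` (\<D> \<times> \<E>)" "B \<in> F ` (\<D> \<times> \<E>)" "A \<noteq> B" "A \<inter> B \<noteq> {}"
    then obtain D E D' E' x where *: "D \<in> \<D>" "E \<in> \<E>" "D' \<in> \<D>" "E' \<in> \<E>"
        "A = F (D, E)" "B = F (D', E')" "x \<in> A" "x \<in> B"
      by blast
    obtain y where "x \<in> D" "(x, y) \<in> s" "y \<in> E"
      using *(5,7) by (auto simp: F_def prestrict_def)
    moreover obtain z where "x \<in> D'" "(x, z) \<in> s" "z \<in> E'"
      using *(6,8) by (auto simp: F_def prestrict_def)
    ultimately have "D \<inter> D' \<noteq> {}" "E \<inter> E' \<noteq> {}"
      using sv by blast+
    then have "D = D'" "E = E'"
      using \<D>(2) \<E>(2) *(1-4) by (meson disjointD)+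
    then show False
      using AB(3) * by simp
  qed
  moreover have "finite (F ` (\<D> \<times> \<E>))"
    using \<D>(1) \<E>(1) by simp
  ultimately show ?thesis
    unfolding hat_iff using pb by (intro conjI exI[of _ "F ` (\<D> \<times> \<E>)"])
qed

lemma local_pairs_comp:
  assumes "(f, D) \<in> local_pairs X S" "\<gamma> \<in> carrier (Gamma X S)"
  shows "(f O \<gamma>, D) \<in> local_pairs X S"
proof -
  have "f \<in> hat X S" "\<gamma> \<in> hat X S" "Domain \<gamma> = X" "Domain f = D" "D \<in> nonempty_doms S"
    using assms by (auto simp: local_pairs_def locally_determined_def Gamma_def)
  moreover from this have "Range f \<subseteq> X"
    by (auto simp: hat_iff partial_bijection_def)
  ultimately have "f O \<gamma> \<in> hat X S" "Domain (f O \<gamma>) = D"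
    by (simp_all add: hat_comp) blast
  with \<open>D \<in> nonempty_doms S\<close> show ?thesis
    by (simp add: local_pairs_def locally_determined_def)
qed

lemma class_translate_eq:
  assumes "(f, D) \<in> local_pairs X S" "\<gamma> \<in> carrier (Gamma X S)"
  shows "class_translate X S SS \<gamma> (pair_class X S SS f D) = pair_class X S SS (f O \<gamma>) D"
proof -
  have "pair_class X S SS (g O \<gamma>) E = pair_class X S SS (f O \<gamma>) D"
    if gE: "(g, E) \<in> pair_class X S SS f D" for g E
  proof -
    obtain h where "h \<in> SS D E" "f = h O g"
      using in_pair_classD(2)[OF assms(1) gE] by blast
    then have "\<exists>h \<in> SS D E. f O \<gamma> = h O (g O \<gamma>)"
      by (auto simp: O_assoc)
    then show ?thesis
      using pair_class_eq_iff local_pairs_comp[OF assms]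
        local_pairs_comp[OF in_pair_classD(1)[OF assms(1) gE] assms(2)] by blast
  qed
  then show ?thesis
    using self_in_pair_class[OF assms(1)] unfolding class_translate_def by blast
qed

end

end

theory Submission
  imports Defs
begin

text \<open>
  Two facts are combined. The order complex of a reflexive relation in which every finite set has
  an upper bound is contractible (\<open>contractible_complex_order_complex\<close>), and the
  ordered vertices form such a relation (\<open>ord_vertices_bounded\<close>).

  For the first fact the usual argument is that every finite subcomplex lies in a cone, so that
  all homotopy groups vanish. An explicit contraction takes the place of Whitehead's theorem.
  Choose upper bounds \<open>v \<sigma>\<close> of the finite sets \<open>\<sigma>\<close> that
  lie above a base point and are monotone in \<open>\<sigma>\<close>. A point \<open>t\<close> of
  the realization is the integral over \<open>r > 0\<close> of the indicator functions of its
  superlevel sets \<open>{q. r \<le> t q}\<close>, which form a decreasing family of simplices. The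
  homotopy \<open>push\<close> replaces, at time \<open>s\<close>, the contribution of each level
  \<open>r \<le> s\<close> by a point mass of the same total weight at \<open>v\<close> of the
  superlevel set. At every time the support is a chain: the coordinates that remain exceed
  \<open>s\<close>, hence belong to every superlevel set already replaced and lie below the new
  points, and the new points are comparable because \<open>v\<close> is monotone. At time
  \<open>1\<close> only new points are left; they lie above the base point, and a segment leads
  there. Continuity for the weak topology is checked on each closed simplex times the interval
  (\<open>continuous_map_prod_realization\<close>).

  For the second fact, call a vertex standard if it consists of the classes
  \<open>[id, E]\<close> for the members \<open>E\<close> of a finite partition of
  \<open>X\<close> into domains. Every vertex with classes
  \<open>[f\<^sub>i, D\<^sub>i]\<close> lies below a standard one, because each \<open>f\<^sub>i\<close> is piecewise in \<open>SS\<close> on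
  a partition in \<open>PP D\<^sub>i\<close>, so that the pieces of the class are classes of
  identities. Two standard vertices have a common upper bound by refining twice: first the
  members of the first partition so that the result refines the second one, and then the members
  of the second partition so that the result refines the one just obtained. The restriction of
  the last partitions to a member of the intermediate one is admissible by \<open>P3\<close>, so the
  intermediate standard vertex lies below the last one. Hence finitely many vertices have a common
  upper bound, and one more expansion makes it strict. Strictness is what carries over to ordered
  vertices, where tuples with the same underlying set are incomparable.
\<close>


section \<open>Continuity on the product of a realization with the unit interval\<close>

lemma closed_closed_simplex:
  assumes "finite \<sigma>"
  shows "closed (closed_simplex \<sigma> :: ('v \<Rightarrow> real) set)"
proof -
  have cont: "continuous_on UNIV (\<lambda>t :: 'v \<Rightarrow> real. t x)" for x
    by simp
  have "closed_simplex \<sigma> = (\<Inter>x. {t. 0 \<le> t x}) \<inter> (\<Inter>x\<in>-\<sigma>. {t. t x = 0}) \<inter> {t. sum t \<sigma> = 1}"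
    by (auto simp: closed_simplex_def)
  also have "closed \<dots>"
    by (intro closed_Int closed_INT ballI closed_Collect_le closed_Collect_eq
        continuous_on_sum continuous_on_const cont)
  finally show ?thesis .
qed

text \<open>The weak topology is compatible with the product by a compact interval. Around a point of
  \<open>W\<close>, a compact interval \<open>J\<close> fits into the vertical slice, and the set of
  all \<open>y\<close> with \<open>J \<times> {y} \<subseteq> W\<close> is open in each closed simplex by the
  tube lemma, hence open in the realization.\<close>

lemma openin_prod_realization:
  assumes W: "W \<subseteq> {0..1::real} \<times> topspace (realization K)"
    and loc: "\<And>\<rho>. \<rho> \<in> K \<Longrightarrow>
      openin (top_of_set ({0..1} \<times> closed_simplex \<rho>)) (W \<inter> {0..1} \<times> closed_simplex \<rho>)"
  shows "openin (prod_topology (top_of_set {0..1}) (realization K)) W"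
  unfolding openin_prod_topology_alt
proof (intro allI impI)
  fix u x assume ux: "(u, x) \<in> W"
  then have u: "u \<in> {0..1}" and "x \<in> topspace (realization K)"
    using W by auto
  then obtain \<rho> where \<rho>: "\<rho> \<in> K" "x \<in> closed_simplex \<rho>"
    by (auto simp: topspace_realization)
  have "openin (top_of_set {0..1})
      ({0..1} \<inter> (\<lambda>a. (a, x)) -` (W \<inter> {0..1} \<times> closed_simplex \<rho>))"
    using \<rho> by (intro continuous_openin_preimage[OF _ _ loc] continuous_intros) auto
  moreover have "u \<in> {0..1} \<inter> (\<lambda>a. (a, x)) -` (W \<inter> {0..1} \<times> closed_simplex \<rho>)"
    using ux u \<rho> by simp
  ultimately obtain e where e: "e > 0"
      "cball u e \<inter> {0..1} \<subseteq> {0..1} \<inter> (\<lambda>a. (a, x)) -` (W \<inter> {0..1} \<times> closed_simplex \<rho>)"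
    unfolding openin_contains_cball by blast
  define J where "J = cball u e \<inter> {0..1}"
  have J: "J \<subseteq> {0..1}" "compact J"
    by (auto simp: J_def compact_Int_closed)
  define V where "V = {y \<in> topspace (realization K). J \<times> {y} \<subseteq> W}"
  have "openin (top_of_set (closed_simplex \<kappa>)) (V \<inter> closed_simplex \<kappa>)" if "\<kappa> \<in> K" for \<kappa>
  proof -
    have "openin (top_of_set (J \<times> closed_simplex \<kappa>))
        ((J \<times> closed_simplex \<kappa>) \<inter> (W \<inter> {0..1} \<times> closed_simplex \<kappa>))"
      using loc[OF that] J(1) unfolding openin_open by blast
    moreover have "(J \<times> closed_simplex \<kappa>) \<inter> (W \<inter> {0..1} \<times> closed_simplex \<kappa>) =
        J \<times> closed_simplex \<kappa> - (J \<times> closed_simplex \<kappa> - W)"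
      using J(1) by blast
    ultimately have "closedin (top_of_set (J \<times> closed_simplex \<kappa>)) (J \<times> closed_simplex \<kappa> - W)"
      by (simp add: closedin_def Diff_subset)
    moreover have "closed_map (prod_topology (top_of_set J) (top_of_set (closed_simplex \<kappa>)))
        (top_of_set (closed_simplex \<kappa>)) snd"
      using J(2) by (intro Abstract_Topological_Spaces.closed_map_snd) (simp add: compact_space_subtopology)
    ultimately have "closedin (top_of_set (closed_simplex \<kappa>)) (snd ` (J \<times> closed_simplex \<kappa> - W))"
      unfolding closed_map_def by (simp flip: subtopology_Times)
    then have "openin (top_of_set (closed_simplex \<kappa>))
        (closed_simplex \<kappa> - snd ` (J \<times> closed_simplex \<kappa> - W))"
      by (simp add: openin_diff)
    moreover have "closed_simplex \<kappa> - snd ` (J \<times> closed_simplex \<kappa> - W) = V \<inter> closed_simplex \<kappa>"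
      using that by (force simp: V_def topspace_realization)
    ultimately show ?thesis
      by simp
  qed
  then have "openin (realization K) V"
    by (auto simp: openin_realization V_def topspace_realization)
  moreover have "openin (top_of_set {0..1}) ({0..1} \<inter> ball u e)"
    by (rule openin_open_Int) simp
  moreover have "u \<in> {0..1} \<inter> ball u e" "x \<in> V"
    using u e \<open>x \<in> topspace _\<close> by (auto simp: V_def J_def)
  moreover have "({0..1} \<inter> ball u e) \<times> V \<subseteq> W"
    by (auto simp: V_def J_def)
  ultimately show "\<exists>A B. openin (top_of_set {0..1}) A \<and> openin (realization K) B \<and> u \<in> A \<and> x \<in> B \<and> A \<times> B \<subseteq> W"
    by blast
qed

text \<open>The bounding sets \<open>T \<rho>\<close> confine the image of one closed simplex to finitely many closed
  simplices, whose union carries the topology of coordinatewise convergence. This is why continuity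
  of the coordinates suffices.\<close>

lemma continuous_map_prod_realization:
  fixes h :: "real \<times> ('v \<Rightarrow> real) \<Rightarrow> ('w \<Rightarrow> real)"
  assumes L_finite: "\<And>\<kappa>. \<kappa> \<in> L \<Longrightarrow> finite \<kappa>"
    and T: "\<And>\<rho>. \<rho> \<in> K \<Longrightarrow> finite (T \<rho>)"
    and mem: "\<And>\<rho> u x. \<rho> \<in> K \<Longrightarrow> u \<in> {0..1} \<Longrightarrow> x \<in> closed_simplex \<rho> \<Longrightarrow>
      \<exists>\<kappa>\<in>L. \<kappa> \<subseteq> T \<rho> \<and> h (u, x) \<in> closed_simplex \<kappa>"
    and cont: "\<And>\<rho> p. \<rho> \<in> K \<Longrightarrow> continuous_on ({0..1} \<times> closed_simplex \<rho>) (\<lambda>z. h z p)"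
  shows "continuous_map (prod_topology (top_of_set {0..1}) (realization K)) (realization L) h"
  unfolding continuous_map_def
proof (intro conjI allI impI)
  show "h \<in> topspace (prod_topology (top_of_set {0..1}) (realization K)) \<rightarrow> topspace (realization L)"
    using mem by (fastforce simp: topspace_realization)
  fix U assume U: "openin (realization L) U"
  let ?W = "{z \<in> topspace (prod_topology (top_of_set {0..1}) (realization K)). h z \<in> U}"
  show "openin (prod_topology (top_of_set {0..1}) (realization K)) ?W"
  proof (rule openin_prod_realization)
    show "?W \<subseteq> {0..1} \<times> topspace (realization K)"
      by auto
    fix \<rho> assume \<rho>: "\<rho> \<in> K"
    let ?D = "{0..1::real} \<times> closed_simplex \<rho>"
    let ?L = "{\<kappa> \<in> L. \<kappa> \<subseteq> T \<rho>}"
    have "closedin (top_of_set ?D) (?D \<inter> h -` (closed_simplex \<kappa> - U))" if "\<kappa> \<in> L" for \<kappa>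
    proof -
      have "openin (top_of_set (closed_simplex \<kappa>)) (U \<inter> closed_simplex \<kappa>)"
        using U that by (simp add: openin_realization)
      then have "closedin (top_of_set (closed_simplex \<kappa>)) (closed_simplex \<kappa> - U \<inter> closed_simplex \<kappa>)"
        by (simp add: closedin_diff)
      then have "closed (closed_simplex \<kappa> - U)"
        using closedin_closed_trans closed_closed_simplex[OF L_finite[OF that]]
        by (metis Diff_Int2 Int_absorb Diff_Int_distrib2 Int_commute)
      then show ?thesis
        using cont[OF \<rho>] by (intro continuous_closedin_preimage continuous_on_coordinatewise_then_product)
    qed
    moreover have "finite ?L"
      using T[OF \<rho>] by simp
    ultimately have "closedin (top_of_set ?D) (\<Union>\<kappa>\<in>?L. ?D \<inter> h -` (closed_simplex \<kappa> - U))"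
      by (intro closedin_Union) auto
    also have "(\<Union>\<kappa>\<in>?L. ?D \<inter> h -` (closed_simplex \<kappa> - U)) = {z \<in> ?D. h z \<notin> U}"
    proof (intro equalityI subsetI)
      fix z assume z: "z \<in> {z \<in> ?D. h z \<notin> U}"
      then obtain \<kappa> where "\<kappa> \<in> L" "\<kappa> \<subseteq> T \<rho>" "h z \<in> closed_simplex \<kappa>"
        using mem[OF \<rho>, of "fst z" "snd z"] by auto
      then show "z \<in> (\<Union>\<kappa>\<in>?L. ?D \<inter> h -` (closed_simplex \<kappa> - U))"
        using z by auto
    qed auto
    also have "\<dots> = ?D - (?W \<inter> ?D)"
      using \<rho> by (auto simp: topspace_realization)
    finally have "openin (top_of_set ?D) (?D - (?D - (?W \<inter> ?D)))"
      by (simp add: openin_diff)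
    then show "openin (top_of_set ?D) (?W \<inter> ?D)"
      by (simp add: double_diff)
  qed
qed


section \<open>Contractibility of the order complex of a directed relation\<close>

definition superlevel :: "('v \<Rightarrow> real) \<Rightarrow> real \<Rightarrow> 'v set" where
  "superlevel t r = {q. r \<le> t q}"

definition level_length :: "real \<Rightarrow> ('v \<Rightarrow> real) \<Rightarrow> 'v set \<Rightarrow> real" where
  "level_length s t \<sigma> = measure lborel {r. 0 < r \<and> r \<le> s \<and> superlevel t r = \<sigma>}"

text \<open>The factor \<open>card \<sigma>\<close> is the mass that a superlevel set \<open>\<sigma>\<close> contributes per
  unit of the level, so the total mass stays \<open>1\<close>.\<close>

definition push :: "('v set \<Rightarrow> 'v) \<Rightarrow> real \<Rightarrow> ('v \<Rightarrow> real) \<Rightarrow> 'v \<Rightarrow> real" where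
  "push v s t p = max (t p - s) 0 +
     (\<Sum>\<sigma> | \<sigma> \<subseteq> {q. t q \<noteq> 0} \<and> v \<sigma> = p. real (card \<sigma>) * level_length s t \<sigma>)"

definition push_support :: "('v set \<Rightarrow> 'v) \<Rightarrow> real \<Rightarrow> ('v \<Rightarrow> real) \<Rightarrow> 'v set" where
  "push_support v s t =
     {p. s < t p} \<union> v ` {\<sigma>. \<sigma> \<noteq> {} \<and> (\<exists>r. 0 < r \<and> r \<le> s \<and> superlevel t r = \<sigma>)}"

lemma superlevel_subset:
  "t \<in> closed_simplex \<rho> \<Longrightarrow> 0 < r \<Longrightarrow> superlevel t r \<subseteq> \<rho>"
  unfolding superlevel_def closed_simplex_def by force

text \<open>A set occurs as a superlevel set between the largest coordinate outside it and the smallest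
  coordinate in it. Both are extrema of finitely many coordinates, so the length of the interval is
  a continuous function of the point.\<close>

lemma level_interval:
  assumes "finite \<rho>" "t \<in> closed_simplex \<rho>" "\<sigma> \<subseteq> \<rho>" "\<sigma> \<noteq> {}"
  shows "{r. 0 < r \<and> r \<le> s \<and> superlevel t r = \<sigma>} =
    {Max (insert 0 (t ` (\<rho> - \<sigma>))) <.. min s (Min (t ` \<sigma>))}"
proof -
  have fin: "finite \<sigma>"
    using assms by (blast intro: finite_subset)
  have "superlevel t r = \<sigma> \<longleftrightarrow> (\<forall>q\<in>\<sigma>. r \<le> t q) \<and> (\<forall>q\<in>\<rho> - \<sigma>. t q < r)" if "0 < r" for r
  proof -
    have "t q < r" if "q \<notin> \<rho>" for q
      using that assms(2) \<open>0 < r\<close> by (simp add: closed_simplex_def)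
    then show ?thesis
      using assms(3) by (force simp: superlevel_def)
  qed
  then have "{r. 0 < r \<and> r \<le> s \<and> superlevel t r = \<sigma>} =
      {r. 0 < r \<and> r \<le> s \<and> (\<forall>q\<in>\<sigma>. r \<le> t q) \<and> (\<forall>q\<in>\<rho> - \<sigma>. t q < r)}"
    by blast
  also have "\<dots> = {Max (insert 0 (t ` (\<rho> - \<sigma>))) <.. min s (Min (t ` \<sigma>))}"
  proof -
    have "r \<le> Min (t ` \<sigma>) \<longleftrightarrow> (\<forall>q\<in>\<sigma>. r \<le> t q)" for r
      using fin assms(4) by simp
    moreover have "Max (insert 0 (t ` (\<rho> - \<sigma>))) < r \<longleftrightarrow> 0 < r \<and> (\<forall>q\<in>\<rho> - \<sigma>. t q < r)" for r
      using assms(1) by simp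
    ultimately show ?thesis
      unfolding greaterThanAtMost_iff set_eq_iff mem_Collect_eq min.bounded_iff by blast
  qed
  finally show ?thesis .
qed

lemma level_length_eq:
  assumes "finite \<rho>" "t \<in> closed_simplex \<rho>" "\<sigma> \<subseteq> \<rho>" "\<sigma> \<noteq> {}"
  shows "level_length s t \<sigma> = max 0 (min s (Min (t ` \<sigma>)) - Max (insert 0 (t ` (\<rho> - \<sigma>))))"
proof -
  have Ioc: "measure lborel {a<..b} = max 0 (b - a)" for a b :: real
    by (cases "a \<le> b") auto
  show ?thesis
    unfolding level_length_def level_interval[OF assms] Ioc ..
qed

lemma level_length_eq_0:
  "\<nexists>r. 0 < r \<and> r \<le> s \<and> superlevel t r = \<sigma> \<Longrightarrow> level_length s t \<sigma> = 0"
  unfolding level_length_def by (metis (mono_tags, lifting) empty_Collect_eq measure_empty)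

lemma level_length_nonneg: "0 \<le> level_length s t \<sigma>"
  by (simp add: level_length_def)

lemma push_eq:
  assumes "finite \<rho>" "t \<in> closed_simplex \<rho>"
  shows "push v s t p = max (t p - s) 0 +
    (\<Sum>\<sigma> | \<sigma> \<subseteq> \<rho> \<and> v \<sigma> = p. real (card \<sigma>) * level_length s t \<sigma>)"
proof -
  have supp: "{q. t q \<noteq> 0} \<subseteq> \<rho>"
    using assms(2) by (auto simp: closed_simplex_def)
  have "(\<Sum>\<sigma> | \<sigma> \<subseteq> {q. t q \<noteq> 0} \<and> v \<sigma> = p. real (card \<sigma>) * level_length s t \<sigma>) =
      (\<Sum>\<sigma> | \<sigma> \<subseteq> \<rho> \<and> v \<sigma> = p. real (card \<sigma>) * level_length s t \<sigma>)"
  proof (rule sum.mono_neutral_left)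
    show "finite {\<sigma>. \<sigma> \<subseteq> \<rho> \<and> v \<sigma> = p}"
      using assms(1) by simp
    show "\<forall>\<sigma>\<in>{\<sigma>. \<sigma> \<subseteq> \<rho> \<and> v \<sigma> = p} - {\<sigma>. \<sigma> \<subseteq> {q. t q \<noteq> 0} \<and> v \<sigma> = p}.
        real (card \<sigma>) * level_length s t \<sigma> = 0"
      by (auto intro!: level_length_eq_0 simp: superlevel_def)
  qed (use supp in auto)
  then show ?thesis
    by (simp add: push_def)
qed

text \<open>The superlevel sets containing \<open>p\<close> are those of the levels up to \<open>t p\<close>. Summed over
  \<open>p\<close>, this says that the mass moved by time \<open>s\<close> equals the mass taken away.\<close>

lemma sum_level_length:
  assumes "finite \<rho>" "t \<in> closed_simplex \<rho>" "p \<in> \<rho>" "0 \<le> s"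
  shows "(\<Sum>\<sigma> | \<sigma> \<subseteq> \<rho> \<and> p \<in> \<sigma>. level_length s t \<sigma>) = min (t p) s"
proof -
  have emeasure_Ioc: "emeasure lborel {a<..b} \<noteq> \<infinity>" for a b :: real
    by (cases "a \<le> b") auto
  let ?A = "\<lambda>\<sigma>. {r. 0 < r \<and> r \<le> s \<and> superlevel t r = \<sigma>}"
  let ?I = "{\<sigma>. \<sigma> \<subseteq> \<rho> \<and> p \<in> \<sigma>}"
  have "(\<Sum>\<sigma>\<in>?I. level_length s t \<sigma>) = measure lborel (\<Union>\<sigma>\<in>?I. ?A \<sigma>)"
    unfolding level_length_def
  proof (rule measure_finite_Union[symmetric])
    show "finite ?I"
      using assms(1) by simp
    show "disjoint_family_on ?A ?I"
      by (auto simp: disjoint_family_on_def)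
    have A: "?A \<sigma> = {Max (insert 0 (t ` (\<rho> - \<sigma>))) <.. min s (Min (t ` \<sigma>))}" if "\<sigma> \<in> ?I" for \<sigma>
      using that by (intro level_interval assms) auto
    show "?A ` ?I \<subseteq> sets lborel"
    proof (intro image_subsetI)
      fix \<sigma> assume "\<sigma> \<in> ?I"
      then show "?A \<sigma> \<in> sets lborel"
        by (simp only: A) simp
    qed
    fix \<sigma> assume "\<sigma> \<in> ?I"
    show "emeasure lborel (?A \<sigma>) \<noteq> \<infinity>"
      unfolding A[OF \<open>\<sigma> \<in> ?I\<close>] by (rule emeasure_Ioc)
  qed
  also have "(\<Union>\<sigma>\<in>?I. ?A \<sigma>) = {0<..min (t p) s}"
    using superlevel_subset[OF assms(2)] by (auto simp: superlevel_def)
  also have "measure lborel \<dots> = min (t p) s"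
    using assms(2,4) by (simp add: closed_simplex_def)
  finally show ?thesis .
qed

lemma push_in_closed_simplex:
  assumes "finite \<rho>" "t \<in> closed_simplex \<rho>" "0 \<le> s"
  shows "push_support v s t \<subseteq> \<rho> \<union> v ` Pow \<rho>"
    and "push v s t \<in> closed_simplex (push_support v s t)"
proof -
  let ?T = "\<rho> \<union> v ` Pow \<rho>"
  let ?f = "\<lambda>\<sigma>. real (card \<sigma>) * level_length s t \<sigma>"
  have t0: "t p = 0" if "p \<notin> \<rho>" for p
    using that assms(2) by (simp add: closed_simplex_def)
  show sub: "push_support v s t \<subseteq> ?T"
  proof -
    have "{p. s < t p} \<subseteq> \<rho>"
      using t0 assms(3) by force
    then show ?thesis
      using superlevel_subset[OF assms(2)] by (auto simp: push_support_def)
  qed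
  have fin: "finite ?T"
    using assms(1) by simp
  have nonneg: "0 \<le> push v s t p" for p
    by (auto simp: push_def intro!: add_nonneg_nonneg sum_nonneg mult_nonneg_nonneg level_length_nonneg)
  have zero: "push v s t p = 0" if "p \<notin> push_support v s t" for p
  proof -
    \<comment> \<open>For the empty set the factor \<open>card \<sigma>\<close> vanishes, although its levels have positive length
         once \<open>s\<close> exceeds all coordinates.\<close>
    have "?f \<sigma> = 0" if "v \<sigma> = p" for \<sigma>
    proof (cases "\<sigma> = {}")
      case False
      then have "level_length s t \<sigma> = 0"
        using \<open>p \<notin> _\<close> that by (intro level_length_eq_0) (auto simp: push_support_def)
      then show ?thesis
        by simp
    qed simp
    moreover have "t p \<le> s"
      using that by (auto simp: push_support_def)
    ultimately show ?thesis
      unfolding push_def by (simp add: sum.neutral)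
  qed
  have "sum (push v s t) (push_support v s t) = sum (push v s t) ?T"
    using fin sub zero by (intro sum.mono_neutral_left) auto
  also have "\<dots> = (\<Sum>p\<in>?T. max (t p - s) 0) + (\<Sum>p\<in>?T. \<Sum>\<sigma> | \<sigma> \<in> Pow \<rho> \<and> v \<sigma> = p. ?f \<sigma>)"
    by (simp add: push_eq[OF assms(1,2)] sum.distrib)
  also have "(\<Sum>p\<in>?T. \<Sum>\<sigma> | \<sigma> \<in> Pow \<rho> \<and> v \<sigma> = p. ?f \<sigma>) = sum ?f (Pow \<rho>)"
    using assms(1) fin by (intro sum.group) auto
  also have "\<dots> = (\<Sum>\<sigma>\<in>Pow \<rho>. \<Sum>p | p \<in> \<rho> \<and> p \<in> \<sigma>. level_length s t \<sigma>)"
  proof (intro sum.cong refl)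
    fix \<sigma> assume "\<sigma> \<in> Pow \<rho>"
    then have "{p. p \<in> \<rho> \<and> p \<in> \<sigma>} = \<sigma>"
      by auto
    then show "?f \<sigma> = (\<Sum>p | p \<in> \<rho> \<and> p \<in> \<sigma>. level_length s t \<sigma>)"
      by simp
  qed
  also have "\<dots> = (\<Sum>p\<in>\<rho>. \<Sum>\<sigma> | \<sigma> \<in> Pow \<rho> \<and> p \<in> \<sigma>. level_length s t \<sigma>)"
    using assms(1) by (intro sum.swap_restrict) auto
  also have "\<dots> = (\<Sum>p\<in>\<rho>. min (t p) s)"
    by (simp add: sum_level_length[OF assms(1,2) _ assms(3)])
  also have "(\<Sum>p\<in>?T. max (t p - s) 0) = (\<Sum>p\<in>\<rho>. max (t p - s) 0)"
    using fin t0 assms(3) by (intro sum.mono_neutral_right) auto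
  also have "\<dots> + (\<Sum>p\<in>\<rho>. min (t p) s) = (\<Sum>p\<in>\<rho>. t p)"
    unfolding sum.distrib[symmetric] by (intro sum.cong) auto
  also have "\<dots> = 1"
    using assms(2) by (simp add: closed_simplex_def)
  finally show "push v s t \<in> closed_simplex (push_support v s t)"
    using nonneg zero by (simp add: closed_simplex_def)
qed

lemma push_0: "t \<in> closed_simplex \<rho> \<Longrightarrow> push v 0 t = t"
proof
  fix p assume "t \<in> closed_simplex \<rho>"
  moreover have "level_length 0 t \<sigma> = 0" for \<sigma>
    by (rule level_length_eq_0) auto
  ultimately show "push v 0 t p = t p"
    by (simp add: push_def closed_simplex_def)
qed

lemma continuous_on_Min_image:
  fixes f :: "'b \<Rightarrow> 'a::topological_space \<Rightarrow> real"
  assumes "finite A" "A \<noteq> {}" "\<And>a. a \<in> A \<Longrightarrow> continuous_on S (f a)"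
  shows "continuous_on S (\<lambda>x. Min ((\<lambda>a. f a x) ` A))"
  using assms by (induction A rule: finite_ne_induct) (auto intro!: continuous_on_min)

lemma continuous_on_Max_image:
  fixes f :: "'b \<Rightarrow> 'a::topological_space \<Rightarrow> real"
  assumes "finite A" "A \<noteq> {}" "\<And>a. a \<in> A \<Longrightarrow> continuous_on S (f a)"
  shows "continuous_on S (\<lambda>x. Max ((\<lambda>a. f a x) ` A))"
  using assms by (induction A rule: finite_ne_induct) (auto intro!: continuous_on_max)

lemma continuous_on_push:
  assumes "finite \<rho>"
  shows "continuous_on ({0..1} \<times> closed_simplex \<rho>) (\<lambda>z. push v (fst z) (snd z) p)"
proof -
  let ?D = "{0..1} \<times> closed_simplex \<rho>"
  have snd: "continuous_on ?D (\<lambda>z. snd z q)" for q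
    by (rule continuous_on_product_then_coordinatewise[OF continuous_on_snd[OF continuous_on_id]])
  have len: "continuous_on ?D (\<lambda>z. level_length (fst z) (snd z) \<sigma>)" if "\<sigma> \<subseteq> \<rho>" "\<sigma> \<noteq> {}" for \<sigma>
  proof -
    have fin: "finite \<sigma>"
      using that assms by (blast intro: finite_subset)
    have Min: "continuous_on ?D (\<lambda>z. Min (snd z ` \<sigma>))"
      using fin that snd by (intro continuous_on_Min_image)
    have Max: "continuous_on ?D (\<lambda>z. Max (insert 0 (snd z ` (\<rho> - \<sigma>))))"
    proof (cases "\<rho> - \<sigma> = {}")
      case False
      then have "continuous_on ?D (\<lambda>z. max 0 (Max (snd z ` (\<rho> - \<sigma>))))"
        using assms snd by (intro continuous_on_max continuous_on_const continuous_on_Max_image) auto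
      then show ?thesis
        using False assms by (simp add: Max_insert)
    qed (simp only: image_empty Max_singleton continuous_on_const)
    have "continuous_on ?D
        (\<lambda>z. max 0 (min (fst z) (Min (snd z ` \<sigma>)) - Max (insert 0 (snd z ` (\<rho> - \<sigma>)))))"
      by (intro continuous_on_max continuous_on_const continuous_on_diff continuous_on_min
          continuous_on_fst continuous_on_id Min Max)
    then show ?thesis
      by (rule continuous_on_eq) (auto simp: level_length_eq[OF assms _ that])
  qed
  have summand: "continuous_on ?D (\<lambda>z. real (card \<sigma>) * level_length (fst z) (snd z) \<sigma>)" if "\<sigma> \<subseteq> \<rho>" for \<sigma>
    using len[OF that] by (cases "\<sigma> = {}") (auto intro: continuous_on_mult continuous_on_const)
  have "continuous_on ?D (\<lambda>z. max (snd z p - fst z) 0 +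
      (\<Sum>\<sigma> | \<sigma> \<subseteq> \<rho> \<and> v \<sigma> = p. real (card \<sigma>) * level_length (fst z) (snd z) \<sigma>))"
    by (intro continuous_on_add continuous_on_max continuous_on_diff continuous_on_fst
        continuous_on_id continuous_on_const continuous_on_sum snd summand) simp
  then show ?thesis
    by (rule continuous_on_eq) (auto simp: push_eq[OF assms])
qed

text \<open>By recursion on the size of \<open>\<sigma>\<close>: the value at \<open>\<sigma>\<close> is an upper bound of the base
  point, of \<open>\<sigma>\<close>, and of the finitely many values at proper subsets.\<close>

lemma ex_monotone_upper_bound:
  assumes p0: "p0 \<in> P"
    and refl: "\<And>x. x \<in> P \<Longrightarrow> (x, x) \<in> r"
    and bound: "\<And>A. finite A \<Longrightarrow> A \<subseteq> P \<Longrightarrow> \<exists>z\<in>P. \<forall>a\<in>A. (a, z) \<in> r"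
  obtains v where
    "\<And>\<sigma>. finite \<sigma> \<Longrightarrow> \<sigma> \<subseteq> P \<Longrightarrow> v \<sigma> \<in> P"
    "\<And>\<sigma>. finite \<sigma> \<Longrightarrow> \<sigma> \<subseteq> P \<Longrightarrow> (p0, v \<sigma>) \<in> r"
    "\<And>\<sigma> p. finite \<sigma> \<Longrightarrow> \<sigma> \<subseteq> P \<Longrightarrow> p \<in> \<sigma> \<Longrightarrow> (p, v \<sigma>) \<in> r"
    "\<And>\<sigma> \<tau>. finite \<sigma> \<Longrightarrow> \<sigma> \<subseteq> P \<Longrightarrow> \<tau> \<subseteq> \<sigma> \<Longrightarrow> (v \<tau>, v \<sigma>) \<in> r"
proof -
  define Q where "Q v \<sigma> z \<longleftrightarrow> (finite \<sigma> \<and> \<sigma> \<subseteq> P \<longrightarrow>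
    z \<in> P \<and> (\<forall>a \<in> insert p0 (\<sigma> \<union> v ` {\<tau>. \<tau> \<subset> \<sigma>}). (a, z) \<in> r))" for v \<sigma> z
  have "\<exists>v. \<forall>\<sigma>. Q v \<sigma> (v \<sigma>)"
  proof (rule dependent_wf_choice[OF wf_finite_psubset])
    fix f g :: "'a set \<Rightarrow> 'a" and \<sigma> z
    assume eq: "\<And>\<tau>. (\<tau>, \<sigma>) \<in> finite_psubset \<Longrightarrow> f \<tau> = g \<tau>"
    show "Q f \<sigma> z = Q g \<sigma> z"
    proof (cases "finite \<sigma>")
      case True
      then have "f ` {\<tau>. \<tau> \<subset> \<sigma>} = g ` {\<tau>. \<tau> \<subset> \<sigma>}"
        using eq by (auto simp: finite_psubset_def)
      then show ?thesis
        by (simp add: Q_def)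
    qed (simp add: Q_def)
  next
    fix \<sigma> and f :: "'a set \<Rightarrow> 'a"
    assume IH: "\<And>\<tau>. (\<tau>, \<sigma>) \<in> finite_psubset \<Longrightarrow> Q f \<tau> (f \<tau>)"
    show "\<exists>z. Q f \<sigma> z"
    proof (cases "finite \<sigma> \<and> \<sigma> \<subseteq> P")
      case True
      then have "finite {\<tau>. \<tau> \<subset> \<sigma>}"
        by (auto intro: finite_subset[of _ "Pow \<sigma>"])
      moreover have "f \<tau> \<in> P" if "\<tau> \<subset> \<sigma>" for \<tau>
        using IH[of \<tau>] that True by (auto simp: Q_def finite_psubset_def dest: finite_subset)
      ultimately show ?thesis
        using bound[of "insert p0 (\<sigma> \<union> f ` {\<tau>. \<tau> \<subset> \<sigma>})"] True p0 by (auto simp: Q_def)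
    qed (auto simp: Q_def)
  qed
  then obtain v where v: "Q v \<sigma> (v \<sigma>)" for \<sigma>
    by blast
  show thesis
  proof
    fix \<sigma> assume \<sigma>: "finite \<sigma>" "\<sigma> \<subseteq> P"
    show *: "v \<sigma> \<in> P" "(p0, v \<sigma>) \<in> r" "\<And>p. p \<in> \<sigma> \<Longrightarrow> (p, v \<sigma>) \<in> r"
      using v[of \<sigma>] \<sigma> by (auto simp: Q_def)
    show "(v \<tau>, v \<sigma>) \<in> r" if "\<tau> \<subseteq> \<sigma>" for \<tau>
      using v[of \<sigma>] \<sigma> that refl[OF *(1)] by (cases "\<tau> = \<sigma>") (auto simp: Q_def)
  qed
qed

lemma in_order_complex_iff:
  "\<kappa> \<in> order_complex P r \<longleftrightarrow>
     \<kappa> \<subseteq> P \<and> finite \<kappa> \<and> \<kappa> \<noteq> {} \<and> (\<forall>a\<in>\<kappa>. \<forall>b\<in>\<kappa>. (a, b) \<in> r \<or> (b, a) \<in> r)"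
  by (auto simp: order_complex_def Chains_def)

lemma closed_simplex_nonempty: "t \<in> closed_simplex \<sigma> \<Longrightarrow> \<sigma> \<noteq> {}"
  by (auto simp: closed_simplex_def)

lemma segment_in_closed_simplex:
  assumes t: "t \<in> closed_simplex \<kappa>" and u: "u \<in> {0..1}" and fin: "finite \<kappa>"
  shows "(\<lambda>p. (1 - u) * t p + u * (if p = q then 1 else 0)) \<in> closed_simplex (insert q \<kappa>)"
proof -
  have "sum t (insert q \<kappa>) = sum t \<kappa>"
    using t fin by (intro sum.mono_neutral_right) (auto simp: closed_simplex_def)
  then have "(\<Sum>p\<in>insert q \<kappa>. (1 - u) * t p + u * (if p = q then 1 else 0)) = 1"
    using t fin by (simp add: sum.distrib closed_simplex_def flip: sum_distrib_left)
  then show ?thesis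
    using t u by (simp add: closed_simplex_def)
qed

text \<open>The contraction first runs through \<open>push\<close>, from time \<open>0\<close>, where it is the identity, to
  time \<open>1\<close>, and then along straight segments to the base point. The first half stays in the complex
  because supports of pushed points are chains; the second half does because pushed points at time
  \<open>1\<close> are supported on values of \<open>v\<close>, which lie above the base point.\<close>

theorem contractible_complex_order_complex:
  fixes P :: "'v set"
  assumes r_refl: "\<And>x. x \<in> P \<Longrightarrow> (x, x) \<in> r"
    and bound: "\<And>A. finite A \<Longrightarrow> A \<subseteq> P \<Longrightarrow> \<exists>z\<in>P. \<forall>a\<in>A. (a, z) \<in> r"
  shows "contractible_complex (order_complex P r)"
proof -
  let ?K = "order_complex P r"
  obtain p0 where p0: "p0 \<in> P"
    using bound[of "{}"] by auto
  obtain v where v: "\<And>\<sigma>. finite \<sigma> \<Longrightarrow> \<sigma> \<subseteq> P \<Longrightarrow> v \<sigma> \<in> P"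
      "\<And>\<sigma>. finite \<sigma> \<Longrightarrow> \<sigma> \<subseteq> P \<Longrightarrow> (p0, v \<sigma>) \<in> r"
      "\<And>\<sigma> p. finite \<sigma> \<Longrightarrow> \<sigma> \<subseteq> P \<Longrightarrow> p \<in> \<sigma> \<Longrightarrow> (p, v \<sigma>) \<in> r"
      "\<And>\<sigma> \<tau>. finite \<sigma> \<Longrightarrow> \<sigma> \<subseteq> P \<Longrightarrow> \<tau> \<subseteq> \<sigma> \<Longrightarrow> (v \<tau>, v \<sigma>) \<in> r"
  proof (rule ex_monotone_upper_bound[of p0 P r])
    show "\<exists>z\<in>P. \<forall>a\<in>A. (a, z) \<in> r" if "finite A" "A \<subseteq> P" for A
      using bound that .
  qed (use p0 r_refl in auto)
  have support: "push_support v s t \<in> ?K" if \<rho>: "\<rho> \<in> ?K" and t: "t \<in> closed_simplex \<rho>" and s: "0 \<le> s" for \<rho> t s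
  proof -
    have fin: "finite \<rho>" and sub: "\<rho> \<subseteq> P"
      and chain: "\<And>a b. a \<in> \<rho> \<Longrightarrow> b \<in> \<rho> \<Longrightarrow> (a, b) \<in> r \<or> (b, a) \<in> r"
      using \<rho> by (auto simp: in_order_complex_iff)
    note push = push_in_closed_simplex[OF fin t s, of v]
    have level: "finite (superlevel t x)" "superlevel t x \<subseteq> P" if "0 < x" for x
      using superlevel_subset[OF t that] fin sub by (auto intro: finite_subset)
    have large: "p \<in> \<rho>" if "s < t p" for p
      using that t s by (force simp: closed_simplex_def)
    have "(a, b) \<in> r \<or> (b, a) \<in> r" if ab: "a \<in> push_support v s t" "b \<in> push_support v s t" for a b
    proof -
      have point_level: "(p, v (superlevel t x)) \<in> r" if "s < t p" "0 < x" "x \<le> s" for p x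
        using that v(3)[OF level[OF \<open>0 < x\<close>]] by (simp add: superlevel_def)
      have level_level: "(v (superlevel t x), v (superlevel t y)) \<in> r" if "0 < y" "y \<le> x" for x y
      proof -
        have "superlevel t x \<subseteq> superlevel t y"
          using that by (auto simp: superlevel_def)
        then show ?thesis
          using v(4) level[OF that(1)] by blast
      qed
      consider "s < t a" "s < t b"
        | y where "s < t a" "0 < y" "y \<le> s" "b = v (superlevel t y)"
        | x where "s < t b" "0 < x" "x \<le> s" "a = v (superlevel t x)"
        | x y where "0 < x" "x \<le> s" "a = v (superlevel t x)" "0 < y" "y \<le> s" "b = v (superlevel t y)"
        using ab by (auto simp: push_support_def)
      then show ?thesis
      proof cases
        case (4 x y)
        then show ?thesis
          using level_level by (cases "x \<le> y") auto
      qed (use point_level large chain in auto)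
    qed
    moreover have "push_support v s t \<subseteq> P"
    proof -
      have "v ` Pow \<rho> \<subseteq> P"
        using sub fin v(1) by (auto dest: finite_subset)
      then show ?thesis
        using push(1) sub by blast
    qed
    moreover have "finite (push_support v s t)"
      using push(1) fin by (auto intro: finite_subset)
    ultimately show ?thesis
      using closed_simplex_nonempty[OF push(2)] by (simp add: in_order_complex_iff)
  qed
  have finK: "finite \<kappa>" if "\<kappa> \<in> ?K" for \<kappa>
    using that by (simp add: in_order_complex_iff)
  have cont1: "continuous_map (prod_topology (top_of_set {0..1}) (realization ?K)) (realization ?K)
      (\<lambda>z. push v (fst z) (snd z))"
  proof (rule continuous_map_prod_realization)
    fix \<rho> and u :: real and x assume *: "\<rho> \<in> ?K" "u \<in> {0..1}" "x \<in> closed_simplex \<rho>"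
    then have "0 \<le> u"
      by simp
    then show "\<exists>\<kappa>\<in>?K. \<kappa> \<subseteq> \<rho> \<union> v ` Pow \<rho> \<and> push v (fst (u, x)) (snd (u, x)) \<in> closed_simplex \<kappa>"
      using support[OF *(1,3)] push_in_closed_simplex[OF finK[OF *(1)] *(3)]
      by (intro bexI[of _ "push_support v u x"]) auto
  qed (auto simp: finK intro: continuous_on_push)
  have cont2: "continuous_map (prod_topology (top_of_set {0..1}) (realization ?K)) (realization ?K)
      (\<lambda>z p. (1 - fst z) * push v 1 (snd z) p + fst z * (if p = p0 then 1 else 0))"
  proof (rule continuous_map_prod_realization)
    fix \<rho> and u :: real and x assume *: "\<rho> \<in> ?K" "u \<in> {0..1}" "x \<in> closed_simplex \<rho>"
    let ?S = "push_support v 1 x"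
    have S: "?S \<in> ?K" "?S \<subseteq> \<rho> \<union> v ` Pow \<rho>" "push v 1 x \<in> closed_simplex ?S"
      using support[OF *(1,3)] push_in_closed_simplex[OF finK[OF *(1)] *(3)] by auto
    have "(p0, a) \<in> r" if a: "a \<in> ?S" for a
    proof -
      \<comment> \<open>Coordinates are at most \<open>1\<close>, so at time \<open>1\<close> none of the old support is left.\<close>
      have "x p \<le> 1" for p
      proof (cases "p \<in> \<rho>")
        case True
        then have "x p \<le> sum x \<rho>"
          using *(3) finK[OF *(1)] by (intro member_le_sum) (auto simp: closed_simplex_def)
        then show ?thesis
          using *(3) by (simp add: closed_simplex_def)
      qed (use *(3) in \<open>simp add: closed_simplex_def\<close>)
      then have "\<not> 1 < x a"
        by (simp add: not_less)
      then obtain y where y: "0 < y" "a = v (superlevel x y)"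
        using a by (auto simp: push_support_def)
      have "superlevel x y \<subseteq> \<rho>"
        by (rule superlevel_subset[OF *(3) y(1)])
      then show ?thesis
        unfolding y(2) using *(1) by (intro v(2)) (auto simp: in_order_complex_iff intro: finite_subset)
    qed
    then have "insert p0 ?S \<in> ?K"
      using S(1) p0 r_refl by (auto simp: in_order_complex_iff)
    moreover have "insert p0 ?S \<subseteq> insert p0 (\<rho> \<union> v ` Pow \<rho>)"
      using S(2) by blast
    ultimately show "\<exists>\<kappa>\<in>?K. \<kappa> \<subseteq> insert p0 (\<rho> \<union> v ` Pow \<rho>) \<and>
        (\<lambda>p. (1 - fst (u, x)) * push v 1 (snd (u, x)) p + fst (u, x) * (if p = p0 then 1 else 0))
          \<in> closed_simplex \<kappa>"
      using segment_in_closed_simplex[OF S(3) *(2) finK[OF S(1)]]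
      by (intro bexI[of _ "insert p0 ?S"]) auto
  next
    fix \<rho> p assume "\<rho> \<in> ?K"
    have "continuous_on ({0..1} \<times> closed_simplex \<rho>)
        (\<lambda>z. push v (fst (1::real, snd z)) (snd (1::real, snd z)) p)"
      by (rule continuous_on_compose2[OF continuous_on_push[OF finK[OF \<open>\<rho> \<in> ?K\<close>]]])
        (auto intro!: continuous_on_Pair continuous_on_const continuous_on_snd continuous_on_id)
    then show "continuous_on ({0..1} \<times> closed_simplex \<rho>)
        (\<lambda>z. (1 - fst z) * push v 1 (snd z) p + fst z * (if p = p0 then 1 else 0))"
      by (auto intro!: continuous_on_add continuous_on_mult continuous_on_diff continuous_on_const
          continuous_on_fst continuous_on_id)
  qed (auto simp: finK)
  let ?c = "\<lambda>p. if p = p0 then 1 else 0 :: real"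
  have "homotopic_with (\<lambda>_. True) (realization ?K) (realization ?K) id (push v 1)"
    unfolding homotopic_with[OF refl]
    using cont1 by (intro exI[of _ "\<lambda>z. push v (fst z) (snd z)"]) (auto simp: topspace_realization push_0)
  moreover have "homotopic_with (\<lambda>_. True) (realization ?K) (realization ?K) (push v 1) (\<lambda>_. ?c)"
    unfolding homotopic_with[OF refl]
    using cont2 by (intro exI[of _ "\<lambda>z p. (1 - fst z) * push v 1 (snd z) p + fst z * ?c p"]) auto
  ultimately have "contractible_space (realization ?K)"
    unfolding contractible_space_def by (blast intro: homotopic_with_trans)
  moreover have "?c \<in> closed_simplex {p0}" "{p0} \<in> ?K"
    using p0 r_refl by (auto simp: closed_simplex_def in_order_complex_iff)
  then have "topspace (realization ?K) \<noteq> {}"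
    by (auto simp: topspace_realization)
  ultimately show ?thesis
    by (simp add: contractible_complex_def)
qed


section \<open>Vertices and expansions\<close>

lemma prestrict_eq_Id_on: "prestrict f E = Id_on E O f"
  by (auto simp: prestrict_def)

lemma prestrict_subset: "E \<subseteq> D \<Longrightarrow> prestrict (prestrict f D) E = prestrict f E"
  by (auto simp: prestrict_def)

lemma prestrict_Id_on: "E \<subseteq> D \<Longrightarrow> prestrict (Id_on D) E = Id_on E"
  by (auto simp: prestrict_def)

lemma pair_class_prestrict: "E \<subseteq> D \<Longrightarrow> pair_class X S SS (prestrict f D) E = pair_class X S SS f E"
  by (simp add: pair_class_def prestrict_subset)

lemma pair_class_Id_on: "E \<subseteq> D \<Longrightarrow> pair_class X S SS (Id_on D) E = pair_class X S SS (Id_on E) E"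
  by (simp add: pair_class_def prestrict_Id_on)

context S_structure
begin

abbreviation cls :: "'a rel \<Rightarrow> 'a set \<Rightarrow> ('a rel \<times> 'a set) set" where
  "cls \<equiv> pair_class X S SS"

abbreviation pieces :: "'a rel \<Rightarrow> 'a set set \<Rightarrow> ('a rel \<times> 'a set) set set" where
  "pieces f \<P> \<equiv> cls f ` \<P>"

abbreviation verts :: "('a rel \<times> 'a set) set set set" where
  "verts \<equiv> vertices X S SS"

abbreviation vle (infix "\<preceq>" 50) where
  "v \<preceq> w \<equiv> vertex_le X S SS PP v w"

lemma S_subset_hat: "s \<in> S \<Longrightarrow> s \<in> hat X S"
proof -
  assume s: "s \<in> S"
  moreover have "prestrict s (Domain s) = s"
    by (auto simp: prestrict_def)
  ultimately show ?thesis
    using S_partial_bijection unfolding hat_iff by (intro conjI exI[of _ "{Domain s}"]) auto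
qed

lemma Id_on_in_S: "D \<in> doms S \<Longrightarrow> Id_on D \<in> S"
proof -
  assume "D \<in> doms S"
  then obtain s where s: "s \<in> S" "D = Domain s"
    by (auto simp: doms_def)
  then have "single_valued (s\<inverse>)"
    using S_partial_bijection by (simp add: partial_bijection_def)
  then have "s O s\<inverse> = Id_on D"
    unfolding s(2) single_valued_def by blast
  then show ?thesis
    using S_comp[OF s(1) S_inverse[OF s(1)]] by simp
qed

lemma doms_Int: "D \<in> doms S \<Longrightarrow> E \<in> doms S \<Longrightarrow> D \<inter> E \<in> doms S"
proof -
  assume "D \<in> doms S" "E \<in> doms S"
  then have "Id_on D O Id_on E \<in> S"
    by (intro S_comp Id_on_in_S)
  moreover have "Domain (Id_on D O Id_on E) = D \<inter> E"
    by auto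
  ultimately show ?thesis
    unfolding doms_def by (metis imageI)
qed

lemma Range_in_doms: "s \<in> S \<Longrightarrow> Range s \<in> doms S"
  unfolding doms_def using S_inverse by (metis Domain_converse imageI)

lemma nonempty_doms_iff: "D \<in> nonempty_doms S \<longleftrightarrow> D \<in> doms S \<and> D \<noteq> {}"
  by (simp add: nonempty_doms_def)

lemma local_pairs_iff:
  "(f, D) \<in> local_pairs X S \<longleftrightarrow> D \<in> nonempty_doms S \<and> Domain f = D \<and> f \<in> hat X S"
  by (simp add: local_pairs_def locally_determined_def)

lemma local_pair_inj: "(f, D) \<in> local_pairs X S \<Longrightarrow> (x, z) \<in> f \<Longrightarrow> (y, z) \<in> f \<Longrightarrow> x = y"
  by (auto simp: local_pairs_iff hat_iff partial_bijection_def single_valued_def)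

lemma local_pair_restrict:
  assumes "(f, D) \<in> local_pairs X S" "E \<in> nonempty_doms S" "E \<subseteq> D"
  shows "(prestrict f E, E) \<in> local_pairs X S"
proof -
  have "Id_on E O f \<in> hat X S"
    using assms by (intro hat_comp[OF S_subset_hat[OF Id_on_in_S]])
      (auto simp: nonempty_doms_iff local_pairs_iff)
  moreover have "Domain (prestrict f E) = E"
    using assms by (auto simp: prestrict_def local_pairs_iff)
  ultimately show ?thesis
    using assms by (simp add: local_pairs_iff prestrict_eq_Id_on)
qed

lemma Id_on_local_pair: "D \<in> nonempty_doms S \<Longrightarrow> (Id_on D, D) \<in> local_pairs X S"
  by (auto simp: local_pairs_iff nonempty_doms_iff intro: S_subset_hat Id_on_in_S)

lemma local_pair_reparametrize:
  assumes "(f, D) \<in> local_pairs X S" "D' \<in> nonempty_doms S" "h \<in> SS D' D"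
  shows "(h O f, D') \<in> local_pairs X S" "cls (h O f) D' = cls f D"
proof -
  have D: "D \<in> nonempty_doms S" "Domain f = D" "f \<in> hat X S"
    using assms(1) by (auto simp: local_pairs_iff)
  have h: "Domain h = D'" "Range h = D" "h \<in> S"
    using S1[OF assms(2) D(1) assms(3)] SS_subset[OF assms(2) D(1)] assms(3) by auto
  have "Domain (h O f) = D'"
    using h D(2) by blast
  then show *: "(h O f, D') \<in> local_pairs X S"
    using assms(2) h D by (simp add: local_pairs_iff hat_comp S_subset_hat)
  show "cls (h O f) D' = cls f D"
    using pair_class_eq_iff[OF * assms(1)] assms(3) by blast
qed

lemma PP_piece:
  assumes "D \<in> nonempty_doms S" "\<P> \<in> PP D" "E \<in> \<P>"
  shows "E \<in> nonempty_doms S" "E \<subseteq> D"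
proof -
  have "partition_on D \<P>" "E \<in> doms S"
    using PP_partition[OF assms(1,2)] P2[OF assms(1,2)] assms(3) by auto
  then show "E \<in> nonempty_doms S" "E \<subseteq> D"
    using assms(3) by (auto simp: nonempty_doms_iff partition_on_def)
qed

lemma pair_classes_iff: "b \<in> pair_classes X S SS \<longleftrightarrow> (\<exists>f D. (f, D) \<in> local_pairs X S \<and> b = cls f D)"
  unfolding pair_classes_def quotient_def pair_class_def
  by (auto simp: prestrict_local_pair) (metis prestrict_local_pair)

lemma class_image_restrict:
  assumes "(f, D) \<in> local_pairs X S" "E \<in> nonempty_doms S" "E \<subseteq> D"
  shows "cls f E \<in> pair_classes X S SS" "class_image (cls f E) = f `` E"
proof -
  note r = local_pair_restrict[OF assms]
  show "cls f E \<in> pair_classes X S SS"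
    using r pair_class_prestrict[of E E X S SS f] by (auto simp: pair_classes_iff)
  have "prestrict f E `` E = f `` E"
    by (auto simp: prestrict_def)
  then show "class_image (cls f E) = f `` E"
    using class_image_eq[OF r] pair_class_prestrict[of E E X S SS f] by simp
qed

lemma class_image_nonempty: "b \<in> pair_classes X S SS \<Longrightarrow> class_image b \<noteq> {}"
proof -
  assume "b \<in> pair_classes X S SS"
  then obtain f D where f: "(f, D) \<in> local_pairs X S" "b = cls f D"
    by (auto simp: pair_classes_iff)
  then have "Domain f = D" "D \<noteq> {}"
    by (auto simp: local_pairs_iff nonempty_doms_iff)
  then show ?thesis
    unfolding f(2) class_image_eq[OF f(1)] by auto
qed

text \<open>Injectivity of \<open>f\<close> turns the partition \<open>\<P>\<close> of the domain into a partition of the image, and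
  nonempty images keep different pieces apart.\<close>

lemma pieces_props:
  assumes f: "(f, D) \<in> local_pairs X S" and \<P>: "\<P> \<in> PP D"
  shows "pieces f \<P> \<subseteq> pair_classes X S SS" "finite (pieces f \<P>)" "inj_on (cls f) \<P>"
    "disjoint_family_on class_image (pieces f \<P>)"
    "(\<Union>c\<in>pieces f \<P>. class_image c) = class_image (cls f D)"
proof -
  have D: "D \<in> nonempty_doms S"
    using f by (simp add: local_pairs_iff)
  have part: "partition_on D \<P>"
    by (rule PP_partition[OF D \<P>])
  note E = PP_piece[OF D \<P>]
  note img = class_image_restrict[OF f E]
  show "pieces f \<P> \<subseteq> pair_classes X S SS"
    using img(1) by blast
  show "finite (pieces f \<P>)"
    using P2[OF D \<P>] by simp
  have disj: "class_image (cls f E) \<inter> class_image (cls f F) = {}" if "E \<in> \<P>" "F \<in> \<P>" "E \<noteq> F" for E F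
  proof -
    have "E \<inter> F = {}"
      using partition_onD2[OF part] that by (simp add: disjoint_def)
    then show ?thesis
      using local_pair_inj[OF f] that by (auto simp: img(2))
  qed
  show "inj_on (cls f) \<P>"
  proof (rule inj_onI, rule ccontr)
    fix E F assume "E \<in> \<P>" "F \<in> \<P>" "cls f E = cls f F" "E \<noteq> F"
    then show False
      using disj[of E F] class_image_nonempty[OF img(1)[of E]] by auto
  qed
  show "disjoint_family_on class_image (pieces f \<P>)"
    using disj by (auto simp: disjoint_family_on_def)
  have "(\<Union>c\<in>pieces f \<P>. class_image c) = (\<Union>E\<in>\<P>. f `` E)"
    using img(2) by auto
  also have "\<dots> = f `` D"
    using part by (auto simp: partition_on_def)
  finally show "(\<Union>c\<in>pieces f \<P>. class_image c) = class_image (cls f D)"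
    using class_image_eq[OF f] by simp
qed

lemma vertices_iff:
  "v \<in> verts \<longleftrightarrow> finite v \<and> v \<subseteq> pair_classes X S SS \<and>
     disjoint_family_on class_image v \<and> (\<Union>b\<in>v. class_image b) = X"
  by (simp add: vertices_def)

text \<open>The reparametrization by \<open>h\<close> can be absorbed into the representative of the class, which
  gives a form of the expansions without \<open>h\<close>.\<close>

lemma expansion_iff:
  "expansion X S SS PP v v' \<longleftrightarrow> v \<in> verts \<and>
     (\<exists>f D \<P>. (f, D) \<in> local_pairs X S \<and> cls f D \<in> v \<and> \<P> \<in> PP D \<and> 2 \<le> card \<P> \<and>
        v' = (v - {cls f D}) \<union> pieces f \<P>)"
proof
  assume "expansion X S SS PP v v'"
  then obtain f D D' h \<P> where *: "v \<in> verts" "(f, D) \<in> local_pairs X S" "cls f D \<in> v"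
      "D' \<in> nonempty_doms S" "h \<in> SS D' D" "\<P> \<in> PP D'" "card \<P> \<ge> 2"
      "v' = (v - {cls f D}) \<union> {cls (h O f) E | E. E \<in> \<P>}"
    unfolding expansion_def by auto
  then show "v \<in> verts \<and>
     (\<exists>f D \<P>. (f, D) \<in> local_pairs X S \<and> cls f D \<in> v \<and> \<P> \<in> PP D \<and> 2 \<le> card \<P> \<and>
        v' = (v - {cls f D}) \<union> pieces f \<P>)"
    using local_pair_reparametrize[OF *(2,4,5)]
    by (intro conjI exI[of _ "h O f"] exI[of _ D'] exI[of _ \<P>]) auto
next
  assume "v \<in> verts \<and>
     (\<exists>f D \<P>. (f, D) \<in> local_pairs X S \<and> cls f D \<in> v \<and> \<P> \<in> PP D \<and> 2 \<le> card \<P> \<and>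
        v' = (v - {cls f D}) \<union> pieces f \<P>)"
  then obtain f D \<P> where *: "v \<in> verts" "(f, D) \<in> local_pairs X S" "cls f D \<in> v"
      "\<P> \<in> PP D" "2 \<le> card \<P>" "v' = (v - {cls f D}) \<union> pieces f \<P>"
    by blast
  then have D: "D \<in> nonempty_doms S"
    by (simp add: local_pairs_iff)
  have "{cls (Id_on D O f) E | E. E \<in> \<P>} = pieces f \<P>"
    using local_pairs_Id_comp[OF *(2)] by auto
  then show "expansion X S SS PP v v'"
    unfolding expansion_def using * D S2[OF D]
    by (intro conjI, simp, rule_tac exI[of _ f], rule_tac exI[of _ D], rule_tac exI[of _ D],
        rule_tac exI[of _ "Id_on D"], rule_tac exI[of _ \<P>]) simp
qed

text \<open>The count of classes is the invariant that shows the expansion order to be antisymmetric: the new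
  pieces number at least two, and they differ from the remaining classes because their images do.\<close>

lemma expansion_vertex:
  assumes "expansion X S SS PP v v'"
  shows "v' \<in> verts" "card v < card v'"
proof -
  obtain f D \<P> where f: "(f, D) \<in> local_pairs X S" and b: "cls f D \<in> v" and \<P>: "\<P> \<in> PP D" "2 \<le> card \<P>"
    and v': "v' = (v - {cls f D}) \<union> pieces f \<P>" and v: "v \<in> verts"
    using assms unfolding expansion_iff by (elim conjE exE)
  let ?b = "cls f D"
  note p = pieces_props[OF f \<P>(1)]
  have fin: "finite v" and sub: "v \<subseteq> pair_classes X S SS"
    and disj: "disjoint_family_on class_image v" and un: "(\<Union>b\<in>v. class_image b) = X"
    using v by (auto simp: vertices_iff)
  have away: "class_image c \<inter> class_image d = {}" if "c \<in> v - {?b}" "d \<in> pieces f \<P>" for c d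
  proof -
    have "class_image d \<subseteq> class_image ?b"
      using p(5) that(2) by blast
    moreover have "class_image c \<inter> class_image ?b = {}"
      using disj b that(1) by (auto simp: disjoint_family_on_def)
    ultimately show ?thesis
      by blast
  qed
  have "disjoint_family_on class_image v'"
    unfolding disjoint_family_on_def v'
  proof (intro ballI impI)
    fix c d assume *: "c \<in> v - {?b} \<union> pieces f \<P>" "d \<in> v - {?b} \<union> pieces f \<P>" "c \<noteq> d"
    then consider "c \<in> v" "d \<in> v" | "c \<in> pieces f \<P>" "d \<in> pieces f \<P>"
      | "c \<in> v - {?b}" "d \<in> pieces f \<P>" | "d \<in> v - {?b}" "c \<in> pieces f \<P>"
      by blast
    then show "class_image c \<inter> class_image d = {}"
    proof cases
      case 1
      then show ?thesis
        using disj *(3) by (auto simp: disjoint_family_on_def)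
    next
      case 2
      then show ?thesis
        using p(4) *(3) by (auto simp: disjoint_family_on_def)
    next
      case 3
      then show ?thesis
        by (rule away)
    next
      case 4
      then show ?thesis
        using away by blast
    qed
  qed
  moreover have "(\<Union>c\<in>v'. class_image c) = X"
  proof -
    have "(\<Union>c\<in>v'. class_image c) = (\<Union>c\<in>v - {?b}. class_image c) \<union> class_image ?b"
      unfolding v' UN_Un p(5) ..
    then show ?thesis
      using un b by blast
  qed
  ultimately show "v' \<in> verts"
    using fin sub p(1,2) by (auto simp: vertices_iff v')
  have "(v - {?b}) \<inter> pieces f \<P> = {}"
  proof (rule ccontr)
    assume "(v - {?b}) \<inter> pieces f \<P> \<noteq> {}"
    then obtain c where c: "c \<in> v - {?b}" "c \<in> pieces f \<P>"
      by blast
    then have "c \<in> pair_classes X S SS"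
      using p(1) by blast
    then show False
      using away[OF c] class_image_nonempty by simp
  qed
  then have "card v' = card (v - {?b}) + card \<P>"
    using fin p(2,3) by (simp add: v' card_Un_disjoint card_image)
  moreover have "card v = Suc (card (v - {?b}))"
    using card_Suc_Diff1[OF fin b] by simp
  ultimately show "card v < card v'"
    using \<P>(2) by simp
qed

lemma vertex_le_refl: "v \<preceq> v"
  by (simp add: vertex_le_def)

lemma vertex_le_trans: "u \<preceq> v \<Longrightarrow> v \<preceq> w \<Longrightarrow> u \<preceq> w"
  by (simp add: vertex_le_def)

lemma vertex_le_vertex:
  assumes "v \<preceq> w" "v \<in> verts"
  shows "w \<in> verts" "v = w \<or> card v < card w"
proof -
  have "w \<in> verts \<and> (v = w \<or> card v < card w)"
    using assms(1) unfolding vertex_le_def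
  proof (induction rule: rtranclp_induct)
    case base
    show ?case
      using assms(2) by simp
  next
    case (step u w)
    then show ?case
      using expansion_vertex[OF step.hyps(2)] by (metis less_trans)
  qed
  then show "w \<in> verts" "v = w \<or> card v < card w"
    by simp_all
qed

text \<open>This condition is checked one class at a time. For vertices it implies the order, as shown in
  \<open>refined_by_imp_le\<close>, and spares the construction of explicit sequences of expansions.\<close>

definition refined_by :: "('a rel \<times> 'a set) set set \<Rightarrow> ('a rel \<times> 'a set) set set \<Rightarrow> bool" where
  "refined_by v w \<longleftrightarrow>
     (\<forall>b\<in>v. \<exists>f D \<P>. (f, D) \<in> local_pairs X S \<and> b = cls f D \<and> \<P> \<in> PP D \<and> pieces f \<P> \<subseteq> w)"

text \<open>A class of \<open>w\<close> outside \<open>v\<close> would have a nonempty image, already covered by the images of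
  \<open>v\<close>, which is impossible because the images of \<open>w\<close> are disjoint.\<close>

lemma vertex_subset_eq:
  assumes "v \<in> verts" "w \<in> verts" "v \<subseteq> w"
  shows "v = w"
proof (rule ccontr)
  assume "v \<noteq> w"
  then obtain c where c: "c \<in> w" "c \<notin> v"
    using assms(3) by blast
  have "c \<in> pair_classes X S SS" and disj: "disjoint_family_on class_image w"
    and un: "(\<Union>b\<in>v. class_image b) = X" "(\<Union>b\<in>w. class_image b) = X"
    using assms(1,2) c(1) by (auto simp only: vertices_iff)
  then obtain x where x: "x \<in> class_image c"
    using class_image_nonempty by blast
  then have "x \<in> X"
    using c(1) un(2) by blast
  then obtain b where b: "b \<in> v" "x \<in> class_image b"
    using un(1) by blast
  then have "b \<in> w" "b \<noteq> c"
    using c assms(3) by blast+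
  then have "class_image b \<inter> class_image c = {}"
    using disj c(1) by (simp add: disjoint_family_on_def)
  then show False
    using b x by blast
qed

text \<open>Expand a class of \<open>v\<close> that is missing from \<open>w\<close>. Its pieces lie in \<open>w\<close>, so one class
  fewer is missing afterwards; and when none is missing, the two vertices coincide.\<close>

lemma refined_by_imp_le:
  assumes "v \<in> verts" "w \<in> verts" "refined_by v w"
  shows "v \<preceq> w"
  using assms
proof (induction "card (v - w)" arbitrary: v rule: less_induct)
  case less
  show ?case
  proof (cases "v \<subseteq> w")
    case True
    then show ?thesis
      using vertex_subset_eq[OF less.prems(1,2)] vertex_le_refl by simp
  next
    case False
    then obtain b where b: "b \<in> v" "b \<notin> w"
      by blast
    then obtain f D \<P> where f: "(f, D) \<in> local_pairs X S" "b = cls f D" "\<P> \<in> PP D" "pieces f \<P> \<subseteq> w"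
      using less.prems(3) by (auto simp: refined_by_def)
    have D: "D \<in> nonempty_doms S"
      using f(1) by (simp add: local_pairs_iff)
    let ?v = "v - {b} \<union> pieces f \<P>"
    \<comment> \<open>A one-element partition would be \<open>{D}\<close>, and its only piece is the class \<open>b\<close> itself.\<close>
    have "2 \<le> card \<P>"
    proof (rule ccontr)
      assume "\<not> 2 \<le> card \<P>"
      moreover have part: "partition_on D \<P>" and "finite \<P>"
        using PP_partition[OF D f(3)] P2[OF D f(3)] by auto
      moreover have "\<P> \<noteq> {}"
        using part D by (auto simp: partition_on_def nonempty_doms_iff)
      ultimately have "card \<P> = 1"
        by (metis One_nat_def card_0_eq less_2_cases not_le)
      then obtain E where "\<P> = {E}"
        by (rule card_1_singletonE)
      then have "\<P> = {D}"
        using part by (simp add: partition_on_def)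
      then show False
        using f(2,4) b(2) by simp
    qed
    then have e: "expansion X S SS PP v ?v"
      unfolding expansion_iff using less.prems(1) f b(1) by blast
    have "card (?v - w) < card (v - w)"
    proof (rule psubset_card_mono)
      show "finite (v - w)"
        using less.prems(1) by (simp add: vertices_iff)
      show "?v - w \<subset> v - w"
        using b f(4) by blast
    qed
    moreover have "refined_by ?v w"
      unfolding refined_by_def
    proof
      fix c assume "c \<in> ?v"
      then consider "c \<in> v" | E where "E \<in> \<P>" "c = cls f E"
        by blast
      then show "\<exists>f D \<P>. (f, D) \<in> local_pairs X S \<and> c = cls f D \<and> \<P> \<in> PP D \<and> pieces f \<P> \<subseteq> w"
      proof cases
        case 1
        then show ?thesis
          using less.prems(3) by (auto simp: refined_by_def)
      next
        case (2 E)
        have E: "E \<in> nonempty_doms S" "E \<subseteq> D"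
          using PP_piece[OF D f(3) 2(1)] by auto
        have "c = cls (prestrict f E) E"
          using 2(2) by (simp add: pair_class_prestrict)
        moreover have "c \<in> w"
          using 2 f(4) by blast
        ultimately show ?thesis
          using local_pair_restrict[OF f(1) E] P1[OF E(1)]
          by (intro exI[of _ "prestrict f E"] exI[of _ E] exI[of _ "{E}"]) simp
      qed
    qed
    ultimately have "?v \<preceq> w"
      using less.hyps less.prems(2) expansion_vertex(1)[OF e] by blast
    then show ?thesis
      using e unfolding vertex_le_def by (rule converse_rtranclp_into_rtranclp[rotated])
  qed
qed

end


section \<open>Common expansions of finitely many vertices\<close>

lemma restrict_partition_eq: "restrict_partition \<Q> E = (\<inter>) E ` \<Q> - {{}}"
  unfolding restrict_partition_def by blast

context S_structure
begin

definition domain_partition :: "'a set set \<Rightarrow> bool" where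
  "domain_partition \<Q> \<longleftrightarrow> partition_on X \<Q> \<and> finite \<Q> \<and> \<Q> \<subseteq> doms S"

definition standard :: "'a set set \<Rightarrow> ('a rel \<times> 'a set) set set" where
  "standard \<Q> = (\<lambda>E. cls (Id_on E) E) ` \<Q>"

lemma domain_partition_piece:
  assumes "domain_partition \<Q>" "E \<in> \<Q>"
  shows "E \<in> nonempty_doms S" "E \<subseteq> X"
proof -
  have "partition_on X \<Q>" "\<Q> \<subseteq> doms S"
    using assms(1) by (auto simp: domain_partition_def)
  then show "E \<in> nonempty_doms S" "E \<subseteq> X"
    using assms(2) partition_onD1[of X \<Q>] partition_onD3[of X \<Q>] by (auto simp: nonempty_doms_iff)
qed

lemma class_image_Id_on: "E \<in> nonempty_doms S \<Longrightarrow> class_image (cls (Id_on E) E) = E"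
  using class_image_eq[OF Id_on_local_pair] by (simp add: Image_Id_on)

lemma standard_vertex:
  assumes "domain_partition \<Q>"
  shows "standard \<Q> \<in> verts"
proof -
  have part: "partition_on X \<Q>" and fin: "finite \<Q>"
    using assms by (auto simp: domain_partition_def)
  note img = class_image_Id_on[OF domain_partition_piece(1)[OF assms]]
  have "disjoint_family_on class_image (standard \<Q>)"
    unfolding disjoint_family_on_def
  proof (intro ballI impI)
    fix b c assume *: "b \<in> standard \<Q>" "c \<in> standard \<Q>" "b \<noteq> c"
    then obtain E F where EF: "E \<in> \<Q>" "F \<in> \<Q>" "b = cls (Id_on E) E" "c = cls (Id_on F) F"
      unfolding standard_def by (elim imageE)
    then have "E \<noteq> F"
      using *(3) by blast
    then show "class_image b \<inter> class_image c = {}"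
      using disjointD[OF partition_onD2[OF part] EF(1,2)] EF img by simp
  qed
  moreover have "(\<Union>b\<in>standard \<Q>. class_image b) = X"
    unfolding standard_def using img partition_onD1[OF part] by simp
  moreover have "standard \<Q> \<subseteq> pair_classes X S SS"
    unfolding standard_def using Id_on_local_pair[OF domain_partition_piece(1)[OF assms]]
    by (intro image_subsetI) (unfold pair_classes_iff, blast)
  ultimately show ?thesis
    using fin by (simp add: vertices_iff standard_def)
qed

text \<open>Where \<open>f\<close> restricts to a member of \<open>SS\<close>, that member itself identifies the piece with
  the class of an identity map.\<close>

lemma cls_eq_Id_on:
  assumes f: "(f, D) \<in> local_pairs X S" and E: "E \<in> nonempty_doms S" "E \<subseteq> D"
    and s: "prestrict f E \<in> S" "prestrict f E \<in> SS E (f `` E)"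
  shows "f `` E \<in> nonempty_doms S" "cls f E = cls (Id_on (f `` E)) (f `` E)"
proof -
  have "f `` E = Range (prestrict f E)"
    by (auto simp: prestrict_def)
  then have "f `` E \<in> doms S"
    using Range_in_doms[OF s(1)] by simp
  moreover have "f `` E \<noteq> {}"
    using class_image_nonempty[OF class_image_restrict(1)[OF f E]] class_image_restrict(2)[OF f E]
    by simp
  ultimately show fE: "f `` E \<in> nonempty_doms S"
    by (simp add: nonempty_doms_iff)
  have "prestrict f E = prestrict f E O Id_on (f `` E)"
    by (auto simp: prestrict_def)
  then have "cls (prestrict f E) E = cls (Id_on (f `` E)) (f `` E)"
    using pair_class_eq_iff[OF local_pair_restrict[OF f E] Id_on_local_pair[OF fE]] s(2) by blast
  then show "cls f E = cls (Id_on (f `` E)) (f `` E)"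
    by (simp add: pair_class_prestrict)
qed

text \<open>Partition each representative \<open>(f, D)\<close> by \<open>S5\<close> into pieces on which \<open>f\<close> belongs to
  \<open>SS\<close>. All pieces are then classes of identities, on the images of the parts.\<close>

lemma vertex_refined_by_standard:
  assumes "v \<in> verts"
  shows "\<exists>\<Q>. domain_partition \<Q> \<and> refined_by v (standard \<Q>)"
proof -
  have v: "finite v" "v \<subseteq> pair_classes X S SS" "disjoint_family_on class_image v"
      "(\<Union>b\<in>v. class_image b) = X"
    using assms by (auto simp only: vertices_iff)
  let ?Q = "\<lambda>b f D \<P>. (f, D) \<in> local_pairs X S \<and> b = cls f D \<and> \<P> \<in> PP D \<and>
    (\<forall>E\<in>\<P>. prestrict f E \<in> S \<and> prestrict f E \<in> SS E (f `` E))"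
  have "\<forall>b\<in>v. \<exists>f D \<P>. ?Q b f D \<P>"
  proof
    fix b assume "b \<in> v"
    then obtain f D where f: "(f, D) \<in> local_pairs X S" "b = cls f D"
      using v(2) pair_classes_iff by blast
    then have "D \<in> nonempty_doms S" "locally_determined X S f D"
      by (auto simp: local_pairs_def)
    then show "\<exists>f D \<P>. ?Q b f D \<P>"
      using S5[of D f] f by blast
  qed
  then have "\<exists>f D \<P>. \<forall>b\<in>v. ?Q b (f b) (D b) (\<P> b)"
    unfolding bchoice_iff .
  then obtain f D \<P> where "\<forall>b\<in>v. ?Q b (f b) (D b) (\<P> b)"
    by (elim exE)
  note Q = bspec[OF this]
  have f: "(f b, D b) \<in> local_pairs X S" "b = cls (f b) (D b)" "\<P> b \<in> PP (D b)" if "b \<in> v" for b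
    using Q[OF that] by blast+
  have D: "D b \<in> nonempty_doms S" if "b \<in> v" for b
    using f(1)[OF that] by (simp add: local_pairs_iff)
  have E: "E \<in> nonempty_doms S" "E \<subseteq> D b" if "b \<in> v" "E \<in> \<P> b" for b E
    using PP_piece[OF D f(3)] that by auto
  have fE: "f b `` E \<in> nonempty_doms S" "cls (f b) E = cls (Id_on (f b `` E)) (f b `` E)"
    if "b \<in> v" "E \<in> \<P> b" for b E
    using cls_eq_Id_on[OF f(1) E] Q that by auto
  have img: "class_image b = f b `` D b" if "b \<in> v" for b
    using class_image_eq[OF f(1)[OF that]] f(2)[OF that] by simp
  have part: "partition_on (D b) (\<P> b)" "finite (\<P> b)" if "b \<in> v" for b
    using PP_partition[OF D f(3)] P2[OF D f(3)] that by auto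
  define \<Q> where "\<Q> = (\<Union>b\<in>v. (\<lambda>E. f b `` E) ` \<P> b)"
  have "partition_on X \<Q>"
  proof (rule partition_onI)
    have "\<Union>\<Q> = (\<Union>b\<in>v. f b `` \<Union>(\<P> b))"
      by (auto simp: \<Q>_def)
    also have "\<dots> = (\<Union>b\<in>v. class_image b)"
      using img partition_onD1[OF part(1)] by simp
    finally show "\<Union>\<Q> = X"
      using v(4) by simp
    show "{} \<notin> \<Q>"
    proof
      assume "{} \<in> \<Q>"
      then obtain b E where "b \<in> v" "E \<in> \<P> b" "{} = f b `` E"
        unfolding \<Q>_def by blast
      then show False
        using fE(1)[of b E] by (simp add: nonempty_doms_iff)
    qed
    fix p q assume pq: "p \<in> \<Q>" "q \<in> \<Q>" "p \<noteq> q"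
    obtain b E where b: "b \<in> v" "E \<in> \<P> b" "p = f b `` E"
      using pq(1) unfolding \<Q>_def by blast
    obtain c F where c: "c \<in> v" "F \<in> \<P> c" "q = f c `` F"
      using pq(2) unfolding \<Q>_def by blast
    have "p \<inter> q = {}"
    proof (cases "b = c")
      case True
      then have "E \<inter> F = {}"
        using disjointD[OF partition_onD2[OF part(1)[OF b(1)]]] b c pq(3) by blast
      then show ?thesis
        using local_pair_inj[OF f(1)[OF b(1)]] True unfolding b(3) c(3) by blast
    next
      case False
      then have "class_image b \<inter> class_image c = {}"
        using v(3) b(1) c(1) by (simp add: disjoint_family_on_def)
      moreover have "p \<subseteq> class_image b" "q \<subseteq> class_image c"
        unfolding b(3) c(3) img[OF b(1)] img[OF c(1)] by (rule Image_mono[OF order_refl E(2)], fact+)+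
      ultimately show ?thesis
        by blast
    qed
    then show "disjnt p q"
      by (simp add: disjnt_def)
  qed
  moreover have "finite \<Q>"
    using v(1) part(2) by (simp add: \<Q>_def)
  moreover have "\<Q> \<subseteq> doms S"
    using fE(1) by (auto simp: \<Q>_def nonempty_doms_iff)
  ultimately have "domain_partition \<Q>"
    by (simp add: domain_partition_def)
  moreover have "refined_by v (standard \<Q>)"
    unfolding refined_by_def
  proof
    fix b assume b: "b \<in> v"
    have "pieces (f b) (\<P> b) \<subseteq> standard \<Q>"
    proof
      fix c assume "c \<in> pieces (f b) (\<P> b)"
      then obtain E where E: "E \<in> \<P> b" "c = cls (f b) E"
        by blast
      then have "f b `` E \<in> \<Q>"
        using b by (auto simp: \<Q>_def)
      then show "c \<in> standard \<Q>"
        unfolding standard_def E(2) fE(2)[OF b E(1)] by (rule imageI)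
    qed
    then show "\<exists>f D \<P>. (f, D) \<in> local_pairs X S \<and> b = cls f D \<and> \<P> \<in> PP D \<and> pieces f \<P> \<subseteq> standard \<Q>"
      using f[OF b] by blast
  qed
  ultimately show ?thesis
    by blast
qed

lemma refine_domain_partition:
  assumes \<Q>: "domain_partition \<Q>" and \<R>: "\<And>D. D \<in> \<Q> \<Longrightarrow> \<R> D \<in> PP D"
  shows "domain_partition (\<Union>D\<in>\<Q>. \<R> D)"
proof -
  note D = domain_partition_piece(1)[OF \<Q>]
  have \<Q>': "partition_on X \<Q>" "finite \<Q>"
    using \<Q> by (auto simp: domain_partition_def)
  have part: "partition_on D (\<R> D)" "finite (\<R> D)" "\<R> D \<subseteq> doms S" if "D \<in> \<Q>" for D
    using PP_partition[OF D \<R>] P2[OF D \<R>] that by auto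
  have "partition_on X (\<Union>D\<in>\<Q>. \<R> D)"
  proof (rule partition_onI)
    have "\<Union>(\<Union>D\<in>\<Q>. \<R> D) = (\<Union>D\<in>\<Q>. \<Union>(\<R> D))"
      by blast
    also have "\<dots> = \<Union>\<Q>"
      using partition_onD1[OF part(1)] by simp
    finally show "\<Union>(\<Union>D\<in>\<Q>. \<R> D) = X"
      using partition_onD1[OF \<Q>'(1)] by simp
    show "{} \<notin> (\<Union>D\<in>\<Q>. \<R> D)"
      using partition_onD3[OF part(1)] by blast
    fix p q assume pq: "p \<in> (\<Union>D\<in>\<Q>. \<R> D)" "q \<in> (\<Union>D\<in>\<Q>. \<R> D)" "p \<noteq> q"
    then obtain D E where DE: "D \<in> \<Q>" "p \<in> \<R> D" "E \<in> \<Q>" "q \<in> \<R> E"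
      by blast
    have "p \<inter> q = {}"
    proof (cases "D = E")
      case True
      then show ?thesis
        using disjointD[OF partition_onD2[OF part(1)[OF DE(1)]]] DE pq(3) by blast
    next
      case False
      then have "D \<inter> E = {}"
        using disjointD[OF partition_onD2[OF \<Q>'(1)]] DE by blast
      moreover have "p \<subseteq> D" "q \<subseteq> E"
        using partition_onD1[OF part(1)] DE by blast+
      ultimately show ?thesis
        by blast
    qed
    then show "disjnt p q"
      by (simp add: disjnt_def)
  qed
  then show ?thesis
    using \<Q>'(2) part(2,3) by (auto simp: domain_partition_def)
qed

lemma standard_refined_by:
  assumes \<Q>: "domain_partition \<Q>" and \<R>: "\<And>D. D \<in> \<Q> \<Longrightarrow> \<R> D \<in> PP D \<and> \<R> D \<subseteq> \<Q>'"
  shows "refined_by (standard \<Q>) (standard \<Q>')"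
  unfolding refined_by_def
proof
  fix b assume "b \<in> standard \<Q>"
  then obtain D where D: "D \<in> \<Q>" "b = cls (Id_on D) D"
    by (auto simp: standard_def)
  note nd = domain_partition_piece(1)[OF \<Q> D(1)]
  have "pieces (Id_on D) (\<R> D) \<subseteq> standard \<Q>'"
  proof
    fix c assume "c \<in> pieces (Id_on D) (\<R> D)"
    then obtain E where E: "E \<in> \<R> D" "c = cls (Id_on D) E"
      by blast
    then have "E \<in> \<Q>'" "E \<subseteq> D"
      using \<R>[OF D(1)] PP_piece(2)[OF nd] by auto
    then show "c \<in> standard \<Q>'"
      using pair_class_Id_on[of E D X S SS] E(2) by (simp add: standard_def)
  qed
  then show "\<exists>f D \<P>. (f, D) \<in> local_pairs X S \<and> b = cls f D \<and> \<P> \<in> PP D \<and> pieces f \<P> \<subseteq> standard \<Q>'"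
    using Id_on_local_pair[OF nd] D \<R>[OF D(1)] by blast
qed

text \<open>This is \<open>P5\<close> applied to the trace of \<open>\<Q>\<close> on \<open>D\<close>.\<close>

lemma PP_refining_trace:
  assumes \<Q>: "domain_partition \<Q>" and D: "D \<in> nonempty_doms S" "D \<subseteq> X"
  obtains \<P> where "\<P> \<in> PP D" "\<And>E. E \<in> \<P> \<Longrightarrow> \<exists>C\<in>\<Q>. E \<subseteq> C"
proof -
  have q: "partition_on X \<Q>" "finite \<Q>" "\<Q> \<subseteq> doms S"
    using \<Q> by (auto simp: domain_partition_def)
  have "partition_on D (restrict_partition \<Q> D)"
    using partition_on_restrict[OF q(1), of D] D(2) by (simp add: restrict_partition_eq Int_absorb2)
  moreover have "finite (restrict_partition \<Q> D)"
    using q(2) by (simp add: restrict_partition_eq)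
  moreover have "restrict_partition \<Q> D \<subseteq> doms S"
    using q(3) D(1) by (auto simp: restrict_partition_eq nonempty_doms_iff intro!: doms_Int)
  ultimately obtain \<P> where \<P>: "\<P> \<in> PP D" "refines D \<P> (restrict_partition \<Q> D)"
    using P5[OF D(1)] by blast
  show thesis
  proof (rule that[OF \<P>(1)])
    fix E assume "E \<in> \<P>"
    then obtain F where "F \<in> restrict_partition \<Q> D" "E \<subseteq> F"
      using \<P>(2) by (auto simp: refines_def)
    then show "\<exists>C\<in>\<Q>. E \<subseteq> C"
      by (auto simp: restrict_partition_eq)
  qed
qed

text \<open>Refining each member of \<open>\<Q>1\<close> gives a partition \<open>\<Q>'\<close> that refines \<open>\<Q>2\<close>, but its trace on a
  member of \<open>\<Q>2\<close> may fail to be in \<open>PP\<close>. A second refinement, now of the members of \<open>\<Q>2\<close>,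
  repairs this, and \<open>P3\<close> shows that it is also admissible on the members of \<open>\<Q>'\<close>.\<close>

lemma standard_common_upper_bound:
  assumes \<Q>1: "domain_partition \<Q>1" and \<Q>2: "domain_partition \<Q>2"
  obtains \<Q> where "domain_partition \<Q>" "standard \<Q>1 \<preceq> standard \<Q>" "standard \<Q>2 \<preceq> standard \<Q>"
proof -
  have "\<forall>D\<in>\<Q>1. \<exists>\<P>. \<P> \<in> PP D \<and> (\<forall>E\<in>\<P>. \<exists>C\<in>\<Q>2. E \<subseteq> C)"
    using PP_refining_trace[OF \<Q>2 domain_partition_piece[OF \<Q>1]] by metis
  from bchoice[OF this] obtain \<A>
    where *: "\<forall>D\<in>\<Q>1. \<A> D \<in> PP D \<and> (\<forall>E\<in>\<A> D. \<exists>C\<in>\<Q>2. E \<subseteq> C)"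
    by (elim exE)
  have \<A>: "\<A> D \<in> PP D" if "D \<in> \<Q>1" for D
    using * that by simp
  have \<A>_sub: "\<exists>C\<in>\<Q>2. E \<subseteq> C" if "D \<in> \<Q>1" "E \<in> \<A> D" for D E
    using * that by simp
  define \<Q>' where "\<Q>' = (\<Union>D\<in>\<Q>1. \<A> D)"
  have \<Q>': "domain_partition \<Q>'"
    unfolding \<Q>'_def by (rule refine_domain_partition[OF \<Q>1 \<A>])
  have le1: "standard \<Q>1 \<preceq> standard \<Q>'"
    using \<A> by (intro refined_by_imp_le standard_vertex \<Q>1 \<Q>' standard_refined_by[where \<R> = \<A>])
      (auto simp: \<Q>'_def)
  have "\<forall>D\<in>\<Q>2. \<exists>\<P>. \<P> \<in> PP D \<and> (\<forall>E\<in>\<P>. \<exists>C\<in>\<Q>'. E \<subseteq> C)"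
    using PP_refining_trace[OF \<Q>' domain_partition_piece[OF \<Q>2]] by metis
  from bchoice[OF this] obtain \<B>
    where *: "\<forall>D\<in>\<Q>2. \<B> D \<in> PP D \<and> (\<forall>E\<in>\<B> D. \<exists>C\<in>\<Q>'. E \<subseteq> C)"
    by (elim exE)
  have \<B>: "\<B> D \<in> PP D" if "D \<in> \<Q>2" for D
    using * that by simp
  have \<B>_sub: "\<exists>C\<in>\<Q>'. E \<subseteq> C" if "D \<in> \<Q>2" "E \<in> \<B> D" for D E
    using * that by simp
  define \<Q> where "\<Q> = (\<Union>D\<in>\<Q>2. \<B> D)"
  have \<Q>: "domain_partition \<Q>"
    unfolding \<Q>_def by (rule refine_domain_partition[OF \<Q>2 \<B>])
  have le2: "standard \<Q>2 \<preceq> standard \<Q>"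
    using \<B> by (intro refined_by_imp_le standard_vertex \<Q>2 \<Q> standard_refined_by[where \<R> = \<B>])
      (auto simp: \<Q>_def)
  \<comment> \<open>A part of \<open>\<B> D\<close> that meets \<open>E\<close> is contained in \<open>E\<close>, so restricting \<open>\<B> D\<close> to \<open>E\<close>
       only discards parts.\<close>
  have "\<exists>\<P>. \<P> \<in> PP E \<and> \<P> \<subseteq> \<Q>" if E: "E \<in> \<Q>'" for E
  proof -
    obtain D where D: "D \<in> \<Q>2" "E \<subseteq> D"
      using E \<A>_sub unfolding \<Q>'_def by blast
    have "restrict_partition (\<B> D) E \<in> PP E"
      using domain_partition_piece(1)[OF \<Q>2 D(1)] domain_partition_piece(1)[OF \<Q>' E] \<B>[OF D(1)] D(2)
      by (intro P3)
    moreover have "restrict_partition (\<B> D) E \<subseteq> \<Q>"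
    proof
      fix F assume "F \<in> restrict_partition (\<B> D) E"
      then obtain P where P: "P \<in> \<B> D" "F = P \<inter> E" "P \<inter> E \<noteq> {}"
        by (auto simp: restrict_partition_def)
      then obtain C where C: "C \<in> \<Q>'" "P \<subseteq> C"
        using \<B>_sub[OF D(1)] by blast
      have "disjoint \<Q>'"
        using \<Q>' partition_onD2 by (auto simp: domain_partition_def)
      then have "C = E"
        using disjointD[OF _ C(1) E] C(2) P(3) by blast
      then have "F = P"
        using P(2) C(2) by blast
      then show "F \<in> \<Q>"
        using P(1) D(1) by (auto simp: \<Q>_def)
    qed
    ultimately show ?thesis
      by blast
  qed
  then obtain \<C> where "\<And>E. E \<in> \<Q>' \<Longrightarrow> \<C> E \<in> PP E \<and> \<C> E \<subseteq> \<Q>"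
    by metis
  then have "standard \<Q>' \<preceq> standard \<Q>"
    by (intro refined_by_imp_le standard_vertex \<Q>' \<Q> standard_refined_by[where \<R> = \<C>])
  then show thesis
    using that[OF \<Q> vertex_le_trans[OF le1] le2] by blast
qed

lemma vertices_directed:
  assumes "v \<in> verts" "w \<in> verts"
  obtains u where "u \<in> verts" "v \<preceq> u" "w \<preceq> u"
proof -
  obtain \<Q>1 where 1: "domain_partition \<Q>1" "refined_by v (standard \<Q>1)"
    using vertex_refined_by_standard[OF assms(1)] by blast
  obtain \<Q>2 where 2: "domain_partition \<Q>2" "refined_by w (standard \<Q>2)"
    using vertex_refined_by_standard[OF assms(2)] by blast
  obtain \<Q> where \<Q>: "domain_partition \<Q>" "standard \<Q>1 \<preceq> standard \<Q>" "standard \<Q>2 \<preceq> standard \<Q>"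
    using standard_common_upper_bound[OF 1(1) 2(1)] .
  show thesis
  proof (rule that[OF standard_vertex[OF \<Q>(1)]])
    show "v \<preceq> standard \<Q>"
      using refined_by_imp_le[OF assms(1) standard_vertex[OF 1(1)] 1(2)] \<Q>(2) by (rule vertex_le_trans)
    show "w \<preceq> standard \<Q>"
      using refined_by_imp_le[OF assms(2) standard_vertex[OF 2(1)] 2(2)] \<Q>(3) by (rule vertex_le_trans)
  qed
qed

lemma vertex_exists: "\<exists>v. v \<in> verts"
proof -
  obtain \<D> where \<D>: "finite \<D>" "\<D> \<subseteq> doms S" "disjoint \<D>" "\<Union>\<D> = X"
    using X_finite_union by blast
  have "partition_on X (\<D> - {{}})"
    unfolding partition_on_def using \<D>(3,4) by (auto intro: pairwise_subset)
  then have "domain_partition (\<D> - {{}})"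
    using \<D> by (auto simp: domain_partition_def)
  then show ?thesis
    using standard_vertex by blast
qed

lemma finite_vertices_bounded:
  assumes "finite A" "A \<subseteq> verts"
  shows "\<exists>u\<in>verts. \<forall>v\<in>A. v \<preceq> u"
  using assms
proof (induction A rule: finite_induct)
  case empty
  then show ?case
    using vertex_exists by blast
next
  case (insert v A)
  then obtain w where w: "w \<in> verts" "\<forall>v\<in>A. v \<preceq> w"
    by blast
  then obtain u where "u \<in> verts" "v \<preceq> u" "w \<preceq> u"
    using vertices_directed[of v w] insert.prems by blast
  then show ?case
    using w(2) vertex_le_trans by blast
qed

end


section \<open>Upper bounds of ordered vertices\<close>

text \<open>Ties are allowed, as different classes can have the same type. A new element is inserted after all
  elements that lie below it.\<close>

lemma ex_sorted_enumeration:
  assumes "finite A"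
    and "\<And>x y. x \<in> A \<Longrightarrow> y \<in> A \<Longrightarrow> P x y \<or> P y x"
    and "\<And>x y z. x \<in> A \<Longrightarrow> y \<in> A \<Longrightarrow> z \<in> A \<Longrightarrow> P x y \<Longrightarrow> P y z \<Longrightarrow> P x z"
  shows "\<exists>xs. distinct xs \<and> set xs = A \<and> sorted_wrt P xs"
  using assms
proof (induction A rule: finite_induct)
  case empty
  show ?case
    by (rule exI[of _ "[]"]) simp
next
  case (insert x A)
  have tot: "P y z \<or> P z y" if "y \<in> insert x A" "z \<in> insert x A" for y z
    using insert.prems(1) that .
  have tr: "P y w" if "y \<in> insert x A" "z \<in> insert x A" "w \<in> insert x A" "P y z" "P z w" for y z w
    using insert.prems(2) that .
  have "\<exists>xs. distinct xs \<and> set xs = A \<and> sorted_wrt P xs"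
  proof (rule insert.IH)
    show "P y z \<or> P z y" if "y \<in> A" "z \<in> A" for y z
      using tot[of y z] that by simp
    show "P y w" if "y \<in> A" "z \<in> A" "w \<in> A" "P y z" "P z w" for y z w
      using tr[of y z w] that by simp
  qed
  then obtain xs where xs: "distinct xs" "set xs = A" "sorted_wrt P xs"
    by blast
  let ?ys = "filter (\<lambda>y. P y x) xs @ x # filter (\<lambda>y. \<not> P y x) xs"
  have above: "P x z" if "z \<in> A" "\<not> P z x" for z
    using tot[of x z] that by blast
  have across: "P y z" if "y \<in> A" "z \<in> A" "P y x" "\<not> P z x" for y z
    using tr[of y x z] above[of z] that by blast
  have "distinct ?ys" "set ?ys = insert x A"
    using xs insert.hyps(2) by auto
  moreover have "sorted_wrt P ?ys"
    using xs above across by (auto simp: sorted_wrt_append sorted_wrt_filter)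
  ultimately show ?case
    by blast
qed

context S_structure
begin

lemma class_type_in_domain_types:
  assumes "b \<in> pair_classes X S SS"
  shows "class_type S SS b \<in> domain_types S SS"
proof -
  obtain f D where f: "(f, D) \<in> local_pairs X S" "b = cls f D"
    using assms pair_classes_iff by blast
  then have "D \<in> nonempty_doms S"
    by (simp add: local_pairs_iff)
  then show ?thesis
    unfolding f(2) class_type_eq[OF f(1)] domain_type_def domain_types_def by (rule quotientI)
qed

lemma ex_ord_vertex:
  assumes R: "linear_order_on (domain_types S SS) R" and v: "v \<in> verts"
  shows "\<exists>bs \<in> ord_vertices X S SS R. set bs = v"
proof -
  have fin: "finite v" and sub: "v \<subseteq> pair_classes X S SS"
    using v by (auto simp only: vertices_iff)
  have type: "class_type S SS b \<in> domain_types S SS" if "b \<in> v" for b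
    using class_type_in_domain_types sub that by blast
  have "refl_on (domain_types S SS) R" "trans R" "total_on (domain_types S SS) R"
    using R by (simp_all add: order_on_defs)
  then have "\<exists>bs. distinct bs \<and> set bs = v \<and>
      sorted_wrt (\<lambda>b c. (class_type S SS b, class_type S SS c) \<in> R) bs"
    using type by (intro ex_sorted_enumeration[OF fin])
      (metis refl_onD total_on_def, metis transD)
  then show ?thesis
    using v by (auto simp: ord_vertices_def)
qed

text \<open>The underlying vertices have a common upper bound \<open>u\<close>. An expansion \<open>w\<close> of \<open>u\<close> has more classes
  than any of them, hence differs from all of them, and every ordering of \<open>w\<close> by types is an upper bound.\<close>

lemma ord_vertices_bounded:
  assumes R: "linear_order_on (domain_types S SS) R"
    and expand: "\<forall>v\<in>verts. \<exists>v'. expansion X S SS PP v v'"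
    and A: "finite A" "A \<subseteq> ord_vertices X S SS R"
  shows "\<exists>z\<in>ord_vertices X S SS R. \<forall>a\<in>A. (a, z) \<in> ord_vertices_order X S SS PP R"
proof -
  have "set ` A \<subseteq> verts"
    using A(2) by (auto simp: ord_vertices_def)
  then obtain u where u: "u \<in> verts" "\<forall>v\<in>set ` A. v \<preceq> u"
    using finite_vertices_bounded[of "set ` A"] A(1) by blast
  obtain w where w: "expansion X S SS PP u w"
    using expand u(1) by blast
  obtain z where z: "z \<in> ord_vertices X S SS R" "set z = w"
    using ex_ord_vertex[OF R expansion_vertex(1)[OF w]] by blast
  have "(a, z) \<in> ord_vertices_order X S SS PP R" if a: "a \<in> A" for a
  proof -
    have "set a \<preceq> u" "set a \<in> verts"
      using u(2) a \<open>set ` A \<subseteq> verts\<close> by auto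
    then have "card (set a) \<le> card u" "set a \<preceq> w"
      using vertex_le_vertex(2) w unfolding vertex_le_def by (force, simp)
    then have "set a \<noteq> w" "set a \<preceq> w"
      using expansion_vertex(2)[OF w] by auto
    then show ?thesis
      using a A(2) z by (auto simp: ord_vertices_order_def)
  qed
  then show ?thesis
    using z(1) by blast
qed

end


section \<open>The action on ordered vertices\<close>

context S_structure
begin

abbreviation tr :: "'a rel \<Rightarrow> ('a rel \<times> 'a set) set \<Rightarrow> ('a rel \<times> 'a set) set" where
  "tr \<equiv> class_translate X S SS"

lemma hat_converse:
  assumes "s \<in> hat X S"
  shows "s\<inverse> \<in> hat X S"
proof -
  obtain \<D> where s: "partial_bijection X s" and \<D>: "finite \<D>" "disjoint \<D>" "Domain s = \<Union>\<D>"
      "\<forall>D\<in>\<D>. prestrict s D \<in> S"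
    using assms unfolding hat_iff by blast
  have sv: "single_valued s" "single_valued (s\<inverse>)"
    using s by (auto simp: partial_bijection_def)
  have "disjoint ((``) s ` \<D>)"
  proof (rule disjointI)
    fix A B assume "A \<in> (``) s ` \<D>" "B \<in> (``) s ` \<D>" "A \<noteq> B"
    then obtain D E where DE: "D \<in> \<D>" "E \<in> \<D>" "A = s `` D" "B = s `` E" "D \<noteq> E"
      by blast
    then have "D \<inter> E = {}"
      using disjointD[OF \<D>(2)] by blast
    then show "A \<inter> B = {}"
      using sv(2) unfolding DE(3,4) single_valued_def by blast
  qed
  moreover have "Domain (s\<inverse>) = \<Union>((``) s ` \<D>)"
  proof -
    have "s `` \<Union>\<D> = Range s"
      unfolding \<D>(3)[symmetric] by blast
    moreover have "s `` \<Union>\<D> = \<Union>((``) s ` \<D>)"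
      by blast
    ultimately show ?thesis
      by simp
  qed
  moreover have "prestrict (s\<inverse>) (s `` D) \<in> S" if "D \<in> \<D>" for D
  proof -
    have "prestrict (s\<inverse>) (s `` D) = (prestrict s D)\<inverse>"
      using sv(2) by (auto simp: prestrict_def dest: single_valuedD)
    then show ?thesis
      using S_inverse \<D>(4) that by simp
  qed
  moreover have "partial_bijection X (s\<inverse>)"
    using s by (auto simp: partial_bijection_def)
  moreover have "finite ((``) s ` \<D>)"
    using \<D>(1) by simp
  ultimately show ?thesis
    unfolding hat_iff by (intro conjI exI[of _ "(``) s ` \<D>"]) blast+
qed

lemma carrier_Gamma_iff: "\<gamma> \<in> carrier (Gamma X S) \<longleftrightarrow> \<gamma> \<in> hat X S \<and> Domain \<gamma> = X \<and> Range \<gamma> = X"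
  by (simp add: Gamma_def)

lemma Gamma_bijective:
  assumes "\<gamma> \<in> carrier (Gamma X S)"
  shows "\<gamma> `` X = X" "\<gamma> O \<gamma>\<inverse> = Id_on X" "\<gamma>\<inverse> O \<gamma> = Id_on X"
    "A \<inter> B = {} \<Longrightarrow> \<gamma> `` A \<inter> \<gamma> `` B = {}"
proof -
  have \<gamma>: "single_valued \<gamma>" "single_valued (\<gamma>\<inverse>)" "Domain \<gamma> = X" "Range \<gamma> = X"
    using assms by (auto simp: carrier_Gamma_iff hat_iff partial_bijection_def)
  show "\<gamma> `` X = X"
    using \<gamma>(3,4) by blast
  show "\<gamma> O \<gamma>\<inverse> = Id_on X"
    using \<gamma>(2) unfolding \<gamma>(3)[symmetric] single_valued_def by blast
  show "\<gamma>\<inverse> O \<gamma> = Id_on X"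
    using \<gamma>(1) unfolding \<gamma>(4)[symmetric] single_valued_def by blast
  show "A \<inter> B = {} \<Longrightarrow> \<gamma> `` A \<inter> \<gamma> `` B = {}"
    using \<gamma>(2) unfolding single_valued_def by blast
qed

lemma Gamma_one: "Id_on X \<in> carrier (Gamma X S)"
proof -
  obtain \<D> where \<D>: "finite \<D>" "\<D> \<subseteq> doms S" "disjoint \<D>" "\<Union>\<D> = X"
    using X_finite_union by blast
  have "prestrict (Id_on X) D \<in> S" if "D \<in> \<D>" for D
  proof -
    have "D \<subseteq> X"
      using that \<D>(4) by blast
    then show ?thesis
      using that \<D>(2) by (simp add: prestrict_Id_on Id_on_in_S subset_iff)
  qed
  then have "Id_on X \<in> hat X S"
    using \<D> unfolding hat_iff
    by (intro conjI exI[of _ \<D>]) (auto simp: partial_bijection_def)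
  then show ?thesis
    by (simp add: carrier_Gamma_iff)
qed

lemma Gamma_mult:
  assumes "\<gamma> \<in> carrier (Gamma X S)" "\<delta> \<in> carrier (Gamma X S)"
  shows "\<gamma> O \<delta> \<in> carrier (Gamma X S)"
proof -
  have "Domain (\<gamma> O \<delta>) = X" "Range (\<gamma> O \<delta>) = X"
    using assms unfolding carrier_Gamma_iff by blast+
  then show ?thesis
    using assms hat_comp by (simp add: carrier_Gamma_iff)
qed

lemma Gamma_inverse: "\<gamma> \<in> carrier (Gamma X S) \<Longrightarrow> \<gamma>\<inverse> \<in> carrier (Gamma X S)"
  by (simp add: carrier_Gamma_iff hat_converse)

lemma group_Gamma: "group (Gamma X S)"
proof (rule groupI)
  fix \<gamma> assume \<gamma>: "\<gamma> \<in> carrier (Gamma X S)"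
  have dom: "Domain \<gamma> = X" "Range \<gamma> = X"
    using \<gamma> by (auto simp: carrier_Gamma_iff)
  have "\<gamma> O Id_on X = \<gamma>"
    unfolding dom(2)[symmetric] by auto
  then show "\<one>\<^bsub>Gamma X S\<^esub> \<otimes>\<^bsub>Gamma X S\<^esub> \<gamma> = \<gamma>"
    by (simp add: Gamma_def)
  show "\<exists>\<delta>\<in>carrier (Gamma X S). \<delta> \<otimes>\<^bsub>Gamma X S\<^esub> \<gamma> = \<one>\<^bsub>Gamma X S\<^esub>"
    using Gamma_inverse[OF \<gamma>] Gamma_bijective(2)[OF \<gamma>]
    by (intro bexI[of _ "\<gamma>\<inverse>"]) (simp_all add: Gamma_def)
next
  fix \<gamma> \<delta> assume "\<gamma> \<in> carrier (Gamma X S)" "\<delta> \<in> carrier (Gamma X S)"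
  then have "\<delta> O \<gamma> \<in> carrier (Gamma X S)"
    using Gamma_mult by blast
  then show "\<gamma> \<otimes>\<^bsub>Gamma X S\<^esub> \<delta> \<in> carrier (Gamma X S)"
    by (simp add: Gamma_def)
next
  have "Id_on X \<in> carrier (Gamma X S)"
    by (rule Gamma_one)
  then show "\<one>\<^bsub>Gamma X S\<^esub> \<in> carrier (Gamma X S)"
    by (simp add: Gamma_def)
qed (simp add: Gamma_def O_assoc)

lemma translate_class:
  assumes "\<gamma> \<in> carrier (Gamma X S)" "b \<in> pair_classes X S SS"
  shows "tr \<gamma> b \<in> pair_classes X S SS" "class_image (tr \<gamma> b) = \<gamma> `` class_image b"
    "class_type S SS (tr \<gamma> b) = class_type S SS b"
proof -
  obtain f D where f: "(f, D) \<in> local_pairs X S" "b = cls f D"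
    using assms(2) pair_classes_iff by blast
  note f' = local_pairs_comp[OF f(1) assms(1)]
  have eq: "tr \<gamma> b = cls (f O \<gamma>) D"
    using class_translate_eq[OF f(1) assms(1)] f(2) by simp
  show "tr \<gamma> b \<in> pair_classes X S SS"
    using f' eq pair_classes_iff by blast
  show "class_image (tr \<gamma> b) = \<gamma> `` class_image b"
    using eq class_image_eq[OF f'] class_image_eq[OF f(1)] f(2) by (simp add: relcomp_Image)
  show "class_type S SS (tr \<gamma> b) = class_type S SS b"
    using eq class_type_eq[OF f'] class_type_eq[OF f(1)] f(2) by simp
qed

lemma translate_mult:
  assumes "\<gamma> \<in> carrier (Gamma X S)" "\<delta> \<in> carrier (Gamma X S)" "b \<in> pair_classes X S SS"
  shows "tr \<delta> (tr \<gamma> b) = tr (\<gamma> O \<delta>) b"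
proof -
  obtain f D where f: "(f, D) \<in> local_pairs X S" "b = cls f D"
    using assms(3) pair_classes_iff by blast
  show ?thesis
    unfolding f(2) class_translate_eq[OF f(1) assms(1)] class_translate_eq[OF f(1) Gamma_mult[OF assms(1,2)]]
      class_translate_eq[OF local_pairs_comp[OF f(1) assms(1)] assms(2)] O_assoc ..
qed

lemma translate_one:
  assumes "b \<in> pair_classes X S SS"
  shows "tr (Id_on X) b = b"
proof -
  obtain f D where f: "(f, D) \<in> local_pairs X S" "b = cls f D"
    using assms pair_classes_iff by blast
  then have "f \<subseteq> X \<times> X"
    by (simp add: local_pairs_iff hat_iff partial_bijection_def)
  then have "f O Id_on X = f"
    by blast
  then show ?thesis
    unfolding f(2) class_translate_eq[OF f(1) Gamma_one] by simp
qed

lemma translate_inverse: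
  assumes "\<gamma> \<in> carrier (Gamma X S)" "b \<in> pair_classes X S SS"
  shows "tr (\<gamma>\<inverse>) (tr \<gamma> b) = b" "tr \<gamma> (tr (\<gamma>\<inverse>) b) = b"
proof -
  note \<gamma>' = Gamma_inverse[OF assms(1)]
  show "tr (\<gamma>\<inverse>) (tr \<gamma> b) = b"
    unfolding translate_mult[OF assms(1) \<gamma>' assms(2)] Gamma_bijective(2)[OF assms(1)]
    by (rule translate_one[OF assms(2)])
  show "tr \<gamma> (tr (\<gamma>\<inverse>) b) = b"
    unfolding translate_mult[OF \<gamma>' assms] Gamma_bijective(3)[OF assms(1)]
    by (rule translate_one[OF assms(2)])
qed

lemma inj_on_translate: "\<gamma> \<in> carrier (Gamma X S) \<Longrightarrow> inj_on (tr \<gamma>) (pair_classes X S SS)"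
  by (rule inj_on_inverseI[of _ "tr (\<gamma>\<inverse>)"]) (rule translate_inverse)

lemma translate_vertex:
  assumes \<gamma>: "\<gamma> \<in> carrier (Gamma X S)" and v: "v \<in> verts"
  shows "tr \<gamma> ` v \<in> verts"
proof -
  have v': "finite v" "v \<subseteq> pair_classes X S SS" "disjoint_family_on class_image v"
      "(\<Union>b\<in>v. class_image b) = X"
    using v by (auto simp only: vertices_iff)
  have mem: "b \<in> pair_classes X S SS" if "b \<in> v" for b
    using v'(2) that by blast
  note t = translate_class[OF \<gamma> mem]
  have "disjoint_family_on class_image (tr \<gamma> ` v)"
    unfolding disjoint_family_on_def
  proof (intro ballI impI)
    fix b c assume *: "b \<in> tr \<gamma> ` v" "c \<in> tr \<gamma> ` v" "b \<noteq> c"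
    then obtain b' c' where bc: "b' \<in> v" "c' \<in> v" "b = tr \<gamma> b'" "c = tr \<gamma> c'"
      by blast
    with *(3) have "b' \<noteq> c'"
      by blast
    then have "class_image b' \<inter> class_image c' = {}"
      using v'(3) bc(1,2) by (simp add: disjoint_family_on_def)
    then show "class_image b \<inter> class_image c = {}"
      unfolding bc(3,4) t(2)[OF bc(1)] t(2)[OF bc(2)] by (rule Gamma_bijective(4)[OF \<gamma>])
  qed
  moreover have "(\<Union>b\<in>tr \<gamma> ` v. class_image b) = X"
  proof -
    have "(\<Union>b\<in>tr \<gamma> ` v. class_image b) = (\<Union>b\<in>v. \<gamma> `` class_image b)"
      using t(2) by simp
    also have "\<dots> = \<gamma> `` X"
      unfolding v'(4)[symmetric] by blast
    finally show ?thesis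
      using Gamma_bijective(1)[OF \<gamma>] by simp
  qed
  moreover have "tr \<gamma> ` v \<subseteq> pair_classes X S SS"
    using t(1) by blast
  ultimately show ?thesis
    using v'(1) by (simp add: vertices_iff)
qed

text \<open>Translation post-composes the representatives with \<open>\<gamma>\<close> and leaves their domains alone, so the
  same partition expands the translated class.\<close>

lemma translate_expansion:
  assumes \<gamma>: "\<gamma> \<in> carrier (Gamma X S)" and e: "expansion X S SS PP v w"
  shows "expansion X S SS PP (tr \<gamma> ` v) (tr \<gamma> ` w)"
proof -
  obtain f D \<P> where f: "(f, D) \<in> local_pairs X S" and b: "cls f D \<in> v" and \<P>: "\<P> \<in> PP D" "2 \<le> card \<P>"
    and w: "w = (v - {cls f D}) \<union> pieces f \<P>" and v: "v \<in> verts"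
    using e unfolding expansion_iff by (elim conjE exE)
  have sub: "v \<subseteq> pair_classes X S SS"
    using v by (simp only: vertices_iff)
  have D: "D \<in> nonempty_doms S"
    using f by (simp add: local_pairs_iff)
  note f' = local_pairs_comp[OF f \<gamma>]
  have eq: "tr \<gamma> (cls f D) = cls (f O \<gamma>) D"
    by (rule class_translate_eq[OF f \<gamma>])
  have "tr \<gamma> (cls f E) = cls (f O \<gamma>) E" if "E \<in> \<P>" for E
  proof -
    have "tr \<gamma> (cls (prestrict f E) E) = cls (prestrict f E O \<gamma>) E"
      using class_translate_eq[OF local_pair_restrict[OF f PP_piece[OF D \<P>(1) that]] \<gamma>] .
    moreover have "prestrict f E O \<gamma> = prestrict (f O \<gamma>) E"
      unfolding prestrict_def by blast
    ultimately show ?thesis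
      by (simp add: pair_class_prestrict)
  qed
  then have "tr \<gamma> ` pieces f \<P> = pieces (f O \<gamma>) \<P>"
    unfolding image_image by (rule image_cong[OF refl])
  moreover have "tr \<gamma> ` (v - {cls f D}) = tr \<gamma> ` v - {tr \<gamma> (cls f D)}"
    using inj_on_image_set_diff[OF inj_on_translate[OF \<gamma>], of v "{cls f D}"] sub b by auto
  ultimately have "tr \<gamma> ` w = (tr \<gamma> ` v - {cls (f O \<gamma>) D}) \<union> pieces (f O \<gamma>) \<P>"
    unfolding w image_Un eq by simp
  moreover have "cls (f O \<gamma>) D \<in> tr \<gamma> ` v"
    unfolding eq[symmetric] using b by (rule imageI)
  ultimately show ?thesis
    unfolding expansion_iff using translate_vertex[OF \<gamma> v] f' \<P> by blast
qed

lemma translate_vertex_le: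
  assumes "\<gamma> \<in> carrier (Gamma X S)" "v \<preceq> w"
  shows "tr \<gamma> ` v \<preceq> tr \<gamma> ` w"
  using assms(2) unfolding vertex_le_def
proof (induction rule: rtranclp_induct)
  case (step u w)
  then show ?case
    using translate_expansion[OF assms(1) step.hyps(2)] by (rule_tac rtranclp.rtrancl_into_rtrancl)
qed simp

lemma ord_vertex_classes: "bs \<in> ord_vertices X S SS R \<Longrightarrow> set bs \<subseteq> pair_classes X S SS"
  by (simp add: ord_vertices_def vertices_iff)

lemma translate_ord_vertex:
  assumes \<gamma>: "\<gamma> \<in> carrier (Gamma X S)" and bs: "bs \<in> ord_vertices X S SS R"
  shows "map (tr \<gamma>) bs \<in> ord_vertices X S SS R"
proof -
  note sub = ord_vertex_classes[OF bs]
  have "inj_on (tr \<gamma>) (set bs)"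
    using inj_on_translate[OF \<gamma>] sub by (rule inj_on_subset)
  then have "distinct (map (tr \<gamma>) bs)"
    using bs by (simp add: ord_vertices_def distinct_map)
  moreover have "set (map (tr \<gamma>) bs) \<in> verts"
    using translate_vertex[OF \<gamma>] bs by (simp add: ord_vertices_def)
  moreover have "sorted_wrt (\<lambda>b c. (class_type S SS b, class_type S SS c) \<in> R) (map (tr \<gamma>) bs)"
  proof -
    have "class_type S SS (tr \<gamma> b) = class_type S SS b" if "b \<in> set bs" for b
      using translate_class(3)[OF \<gamma>] sub that by blast
    moreover have "sorted_wrt (\<lambda>b c. (class_type S SS b, class_type S SS c) \<in> R) bs"
      using bs by (simp add: ord_vertices_def)
    ultimately show ?thesis
      unfolding sorted_wrt_map by (rule_tac sorted_wrt_mono_rel[rotated]) auto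
  qed
  ultimately show ?thesis
    by (simp add: ord_vertices_def)
qed

lemma translate_order:
  assumes \<gamma>: "\<gamma> \<in> carrier (Gamma X S)" and le: "(bs, cs) \<in> ord_vertices_order X S SS PP R"
  shows "(map (tr \<gamma>) bs, map (tr \<gamma>) cs) \<in> ord_vertices_order X S SS PP R"
proof -
  have bs: "bs \<in> ord_vertices X S SS R" and cs: "cs \<in> ord_vertices X S SS R"
    and alt: "bs = cs \<or> set bs \<preceq> set cs \<and> set bs \<noteq> set cs"
    using le by (auto simp: ord_vertices_order_def)
  have "tr \<gamma> ` set bs = tr \<gamma> ` set cs \<longleftrightarrow> set bs = set cs"
    by (rule inj_on_image_eq_iff[OF inj_on_translate[OF \<gamma>] ord_vertex_classes[OF bs] ord_vertex_classes[OF cs]])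
  then show ?thesis
    using alt translate_ord_vertex[OF \<gamma> bs] translate_ord_vertex[OF \<gamma> cs] translate_vertex_le[OF \<gamma>]
    by (auto simp: ord_vertices_order_def)
qed

lemma group_action_ord_vertices:
  "group_action (Gamma X S) (ord_vertices X S SS R) (ord_vertices_action X S SS R)"
proof -
  let ?V = "ord_vertices X S SS R" and ?\<phi> = "ord_vertices_action X S SS R"
  have val: "?\<phi> \<gamma> bs = map (tr \<gamma>) bs" if "bs \<in> ?V" for \<gamma> bs
    using that by (simp add: ord_vertices_action_def)
  have inv: "?\<phi> (\<gamma>\<inverse>) (?\<phi> \<gamma> bs) = bs" "?\<phi> \<gamma> (?\<phi> (\<gamma>\<inverse>) bs) = bs"
    if \<gamma>: "\<gamma> \<in> carrier (Gamma X S)" and bs: "bs \<in> ?V" for \<gamma> bs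
    using translate_ord_vertex[OF \<gamma> bs] translate_ord_vertex[OF Gamma_inverse[OF \<gamma>] bs]
      translate_inverse[OF \<gamma>] ord_vertex_classes[OF bs] bs
    by (auto simp: val intro!: map_idI)
  have Bij: "?\<phi> \<gamma> \<in> Bij ?V" if \<gamma>: "\<gamma> \<in> carrier (Gamma X S)" for \<gamma>
  proof -
    have "bij_betw (?\<phi> \<gamma>) ?V ?V"
      using inv[OF \<gamma>] translate_ord_vertex[OF \<gamma>] translate_ord_vertex[OF Gamma_inverse[OF \<gamma>]]
      by (intro bij_betw_byWitness[where f' = "?\<phi> (\<gamma>\<inverse>)"]) (auto simp: val)
    then show ?thesis
      by (simp add: Bij_def ord_vertices_action_def)
  qed
  have hom: "?\<phi> (\<delta> O \<gamma>) = compose ?V (?\<phi> \<gamma>) (?\<phi> \<delta>)"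
    if "\<gamma> \<in> carrier (Gamma X S)" "\<delta> \<in> carrier (Gamma X S)" for \<gamma> \<delta>
  proof
    fix bs
    show "?\<phi> (\<delta> O \<gamma>) bs = compose ?V (?\<phi> \<gamma>) (?\<phi> \<delta>) bs"
    proof (cases "bs \<in> ?V")
      case True
      have "tr \<gamma> (tr \<delta> b) = tr (\<delta> O \<gamma>) b" if "b \<in> set bs" for b
        using translate_mult[OF \<open>\<delta> \<in> _\<close> \<open>\<gamma> \<in> _\<close>] ord_vertex_classes[OF True] that by blast
      then show ?thesis
        using True translate_ord_vertex[OF \<open>\<delta> \<in> _\<close> True] by (simp add: val compose_def)
    qed (simp add: ord_vertices_action_def compose_def)
  qed
  have "?\<phi> \<in> Group.hom (Gamma X S) (BijGroup ?V)"
  proof (rule homI)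
    fix \<gamma> assume "\<gamma> \<in> carrier (Gamma X S)"
    then show "?\<phi> \<gamma> \<in> carrier (BijGroup ?V)"
      using Bij by (simp add: BijGroup_def)
  next
    fix \<gamma> \<delta> assume *: "\<gamma> \<in> carrier (Gamma X S)" "\<delta> \<in> carrier (Gamma X S)"
    have "\<gamma> \<otimes>\<^bsub>Gamma X S\<^esub> \<delta> = \<delta> O \<gamma>"
      by (simp add: Gamma_def)
    then show "?\<phi> (\<gamma> \<otimes>\<^bsub>Gamma X S\<^esub> \<delta>) = ?\<phi> \<gamma> \<otimes>\<^bsub>BijGroup ?V\<^esub> ?\<phi> \<delta>"
      using hom[OF *] Bij * by (simp add: BijGroup_def)
  qed
  then show ?thesis
    unfolding group_action_def group_hom_def group_hom_axioms_def
    using group_Gamma group_BijGroup by blast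
qed

lemma simplicial_group_action_ord_vertices:
  "simplicial_group_action (Gamma X S) (ord_vertices X S SS R)
     (order_complex (ord_vertices X S SS R) (ord_vertices_order X S SS PP R))
     (ord_vertices_action X S SS R)"
  unfolding simplicial_group_action_def
proof (intro conjI ballI)
  show "group_action (Gamma X S) (ord_vertices X S SS R) (ord_vertices_action X S SS R)"
    by (rule group_action_ord_vertices)
  fix \<gamma> \<sigma> assume \<gamma>: "\<gamma> \<in> carrier (Gamma X S)"
    and \<sigma>: "\<sigma> \<in> order_complex (ord_vertices X S SS R) (ord_vertices_order X S SS PP R)"
  have sub: "\<sigma> \<subseteq> ord_vertices X S SS R"
    using \<sigma> by (simp add: in_order_complex_iff)
  then have "ord_vertices_action X S SS R \<gamma> ` \<sigma> = map (tr \<gamma>) ` \<sigma>"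
    by (intro image_cong) (auto simp: ord_vertices_action_def)
  then show "ord_vertices_action X S SS R \<gamma> ` \<sigma>
      \<in> order_complex (ord_vertices X S SS R) (ord_vertices_order X S SS PP R)"
    unfolding in_order_complex_iff
  proof (simp only:, intro conjI ballI)
    show "map (tr \<gamma>) ` \<sigma> \<subseteq> ord_vertices X S SS R"
      using sub translate_ord_vertex[OF \<gamma>] by blast
    show "finite (map (tr \<gamma>) ` \<sigma>)" "map (tr \<gamma>) ` \<sigma> \<noteq> {}"
      using \<sigma> by (simp_all add: in_order_complex_iff)
    fix a b assume "a \<in> map (tr \<gamma>) ` \<sigma>" "b \<in> map (tr \<gamma>) ` \<sigma>"
    then obtain a' b' where ab: "a' \<in> \<sigma>" "b' \<in> \<sigma>" "a = map (tr \<gamma>) a'" "b = map (tr \<gamma>) b'"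
      by blast
    then have "(a', b') \<in> ord_vertices_order X S SS PP R \<or> (b', a') \<in> ord_vertices_order X S SS PP R"
      using \<sigma> by (simp add: in_order_complex_iff)
    then show "(a, b) \<in> ord_vertices_order X S SS PP R \<or> (b, a) \<in> ord_vertices_order X S SS PP R"
      unfolding ab(3,4) using translate_order[OF \<gamma>] by blast
  qed
qed

end


section \<open>Contractibility of the complex of ordered vertices\<close>

theorem theorem5p12:
  fixes X :: "'a set" and S :: "'a rel set"
    and SS :: "'a set \<Rightarrow> 'a set \<Rightarrow> 'a rel set"
    and PP :: "'a set \<Rightarrow> 'a set set set"
    and R :: "'a set set rel"
  assumes "S_structure X S SS PP"
    and "linear_order_on (domain_types S SS) R"
    and "\<forall>v \<in> vertices X S SS. \<exists>v'. expansion X S SS PP v v'"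
  shows "simplicial_group_action (Gamma X S) (ord_vertices X S SS R)
           (order_complex (ord_vertices X S SS R) (ord_vertices_order X S SS PP R))
           (ord_vertices_action X S SS R)
       \<and> contractible_complex
           (order_complex (ord_vertices X S SS R) (ord_vertices_order X S SS PP R))"
proof
  interpret S_structure X S SS PP
    by fact
  show "simplicial_group_action (Gamma X S) (ord_vertices X S SS R)
      (order_complex (ord_vertices X S SS R) (ord_vertices_order X S SS PP R))
      (ord_vertices_action X S SS R)"
    by (rule simplicial_group_action_ord_vertices)
  show "contractible_complex
      (order_complex (ord_vertices X S SS R) (ord_vertices_order X S SS PP R))"
  proof (rule contractible_complex_order_complex)
    show "(bs, bs) \<in> ord_vertices_order X S SS PP R" if "bs \<in> ord_vertices X S SS R" for bs
      using that by (simp add: ord_vertices_order_def)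
    show "\<exists>z\<in>ord_vertices X S SS R. \<forall>a\<in>A. (a, z) \<in> ord_vertices_order X S SS PP R"
      if "finite A" "A \<subseteq> ord_vertices X S SS R" for A
      using ord_vertices_bounded[OF assms(2,3) that] .
  qed
qed

end
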